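(* Let $\Omega$ be a finite set, $p_0\in\Delta(\Omega)$ a prior with full support, $A$ a compact set of actions, and $u_S,u_R:A\times\Omega\to\mathbb{R}$ continuous. Then the value of optimal ambiguous persuasion at prior $p_0$ is equal to $$\max_{\mu}\ \overline V_S(\mu),$$ where the maximum is over all $\mu\in\Delta(\mathcal{K}(\Omega))$ that are verifiably Bayes plausible, and $$\overline V_S(\mu)=\max_{\varphi\in\Phi_\mu}\ \sum_{P\in\mathrm{supp}(\mu)}\mu(P)\,U_S\big(\hat f_{\varphi(P)}(P),\varphi(P)\big).$$
   Context: For a set $X$, $\Delta(X)$ is the space of probability distributions over $X$ with the weak topology. $\mathcal{K}(\Omega)$ is the set of all (nonempty) closed convex subsets of $\Delta(\Omega)$. For a receiver strategy $f\in\Delta(A)$, a belief $p\in\Delta(\Omega)$ and $i\in\{S,R\}$ (sender, receiver), write $U_i(f,p)=\int_A\sum_{\omega\in\Omega}u_i(a,\omega)p(\omega)\,df(a)$ (equal to $\sum_{a,\omega}f(a)u_i(a,\omega)p(\omega)$ when $f$ has finite support). Receiver's best responses: for $P\in\mathcal{K}(\Omega)$, $\bar f(P)=\arg\max_{f\in\Delta(A)}\min_{p\in P}U_R(f,p)$. For $p\in P$, $\hat f_p(P)\in\bar f(P)$ denotes a sender-preferred element at $p$, i.e. $U_S(\hat f_p(P),p)\ge U_S(f,p)$ for all $f\in\bar f(P)$. A (finitely supported) distribution $\mu\in\Delta(\mathcal{K}(\Omega))$ is verifiably Bayes plausible if there exists a selection function $\varphi:\mathcal{K}(\Omega)\to\Delta(\Omega)$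 with $\varphi(P)\in P$ for all $P$ such that $\sum_{P\in\mathrm{supp}(\mu)}\mu(P)\varphi(P)=p_0$; $\Phi_\mu$ denotes the set of all such $\varphi$ (verifying selections of $\mu$). Devices: given a finite message space $M$, a probabilistic device is a map $\pi:\Omega\to\Delta(M)$, written $\pi(m|\omega)$; $\tau_\pi(m)=\sum_\omega p_0(\omega)\pi(m|\omega)$. An ambiguous device $\Pi$ is a closed and convex (nonempty) set of probabilistic devices on a common finite $M$ with common support: for all $\pi,\pi'\in\Pi$ and $m\in M$, $\tau_\pi(m)>0$ iff $\tau_{\pi'}(m)>0$. For $m$ with $\tau_\pi(m)>0$, the posterior is $p_m^\pi(\omega)=\pi(m|\omega)p_0(\omega)/\tau_\pi(m)$, and $P_m^\Pi=\{p_m^\pi:\pi\in\Pi\}\in\mathcal{K}(\Omega)$ is the receiver's set of posteriors (full Bayesian updating). The value (to the sender, a maxmin expected utility maximizer) of an ambiguous device $\Pi$ is $$\min_{\pi\in\Pi}\ \sum_{m:\tau_\pi(m)>0}\tau_\pi(m)\,U_S\big(\hat f_{p_m^\pi}(P_m^\Pi),p_m^\pi\big).$$ The value of optimal ambiguous persuasion at $p_0$ is the supremum of the values of all ambiguous devices, over all finite message spaces. *)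

theory Defs
  imports "HOL-Probability.Probability"
begin

text \<open>
  The states \<open>\<Omega>\<close> are the elements of a finite type \<open>'w\<close>.  Beliefs are vectors in \<open>real ^ 'w\<close>, so that
  \<^const>\<open>closed\<close> and \<^const>\<open>convex\<close> have their usual meaning for sets of beliefs.
\<close>

definition beliefs :: "(real ^ 'w::finite) set" where
  "beliefs = {p. (\<forall>\<omega>. 0 \<le> p $ \<omega>) \<and> (\<Sum>\<omega>\<in>UNIV. p $ \<omega>) = 1}"

definition belief_sets :: "(real ^ 'w::finite) set set" where
  "belief_sets = {P. P \<noteq> {} \<and> closed P \<and> convex P \<and> P \<subseteq> beliefs}"

text \<open>Receiver strategies: the Borel probability measures on the subspace \<open>A\<close>.\<close>

definition strategies :: "'a::topological_space set \<Rightarrow> 'a measure set" where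
  "strategies A = space (prob_algebra (restrict_space borel A))"

definition exp_util :: "('a \<Rightarrow> 'w \<Rightarrow> real) \<Rightarrow> 'a measure \<Rightarrow> real ^ 'w::finite \<Rightarrow> real" where
  "exp_util u f p = (\<integral>a. (\<Sum>\<omega>\<in>UNIV. u a \<omega> * p $ \<omega>) \<partial>f)"

definition best_responses ::
  "'a::topological_space set \<Rightarrow> ('a \<Rightarrow> 'w \<Rightarrow> real) \<Rightarrow> (real ^ 'w::finite) set \<Rightarrow> 'a measure set" where
  "best_responses A uR P =
     {f. is_arg_max (\<lambda>g. INF p\<in>P. exp_util uR g p) (\<lambda>g. g \<in> strategies A) f}"

text \<open>\<open>preferred_response A uS uR p P\<close> is \<open>f\<^sub>p(P)\<close> (with a hat): some element of
  \<open>best_responses A uR P\<close> that maximises the sender's expected utility at \<open>p\<close>.\<close>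

definition preferred_response ::
  "'a::topological_space set \<Rightarrow> ('a \<Rightarrow> 'w \<Rightarrow> real) \<Rightarrow> ('a \<Rightarrow> 'w \<Rightarrow> real)
     \<Rightarrow> real ^ 'w::finite \<Rightarrow> (real ^ 'w) set \<Rightarrow> 'a measure" where
  "preferred_response A uS uR p P =
     arg_max (\<lambda>f. exp_util uS f p) (\<lambda>f. f \<in> best_responses A uR P)"

definition sender_util ::
  "'a::topological_space set \<Rightarrow> ('a \<Rightarrow> 'w \<Rightarrow> real) \<Rightarrow> ('a \<Rightarrow> 'w \<Rightarrow> real)
     \<Rightarrow> (real ^ 'w::finite) set \<Rightarrow> real ^ 'w \<Rightarrow> real" where
  "sender_util A uS uR P p = exp_util uS (preferred_response A uS uR p P) p"

text \<open>
  Finite message spaces are finite sets \<open>M\<close> of natural numbers, which covers every finite message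
  space up to renaming of messages.  A device is written \<open>\<pi> \<omega> m\<close> for \<open>\<pi>(m|\<omega>)\<close>; it is \<open>0\<close> outside \<open>M\<close>.
\<close>

definition devices :: "nat set \<Rightarrow> ('w::finite \<Rightarrow> nat \<Rightarrow> real) set" where
  "devices M = {\<pi>. \<forall>\<omega>. (\<forall>m. 0 \<le> \<pi> \<omega> m) \<and> (\<forall>m. m \<notin> M \<longrightarrow> \<pi> \<omega> m = 0) \<and> (\<Sum>m\<in>M. \<pi> \<omega> m) = 1}"

definition msg_prob :: "real ^ 'w::finite \<Rightarrow> ('w \<Rightarrow> nat \<Rightarrow> real) \<Rightarrow> nat \<Rightarrow> real" where
  "msg_prob p0 \<pi> m = (\<Sum>\<omega>\<in>UNIV. p0 $ \<omega> * \<pi> \<omega> m)"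

definition posterior :: "real ^ 'w::finite \<Rightarrow> ('w \<Rightarrow> nat \<Rightarrow> real) \<Rightarrow> nat \<Rightarrow> real ^ 'w" where
  "posterior p0 \<pi> m = (\<chi> \<omega>. \<pi> \<omega> m * p0 $ \<omega> / msg_prob p0 \<pi> m)"

definition posterior_set ::
  "real ^ 'w::finite \<Rightarrow> ('w \<Rightarrow> nat \<Rightarrow> real) set \<Rightarrow> nat \<Rightarrow> (real ^ 'w) set" where
  "posterior_set p0 D m = (\<lambda>\<pi>. posterior p0 \<pi> m) ` D"

text \<open>
  Closedness refers to the product topology on the function type; on \<open>devices M\<close> with \<open>M\<close> finite this is
  the Euclidean topology.  Convexity is spelled out because function types carry no vector space
  structure in the library.
\<close>

definition ambiguous_device ::
  "real ^ 'w::finite \<Rightarrow> nat set \<Rightarrow> ('w \<Rightarrow> nat \<Rightarrow> real) set \<Rightarrow> bool" where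
  "ambiguous_device p0 M D \<longleftrightarrow>
     finite M \<and> D \<noteq> {} \<and> D \<subseteq> devices M \<and> closed D \<and>
     (\<forall>\<pi>\<in>D. \<forall>\<pi>'\<in>D. \<forall>t\<in>{0..1}. (\<lambda>\<omega> m. (1 - t) * \<pi> \<omega> m + t * \<pi>' \<omega> m) \<in> D) \<and>
     (\<forall>\<pi>\<in>D. \<forall>\<pi>'\<in>D. \<forall>m\<in>M. 0 < msg_prob p0 \<pi> m \<longleftrightarrow> 0 < msg_prob p0 \<pi>' m)"

definition device_value ::
  "'a::topological_space set \<Rightarrow> ('a \<Rightarrow> 'w \<Rightarrow> real) \<Rightarrow> ('a \<Rightarrow> 'w \<Rightarrow> real)
     \<Rightarrow> real ^ 'w::finite \<Rightarrow> nat set \<Rightarrow> ('w \<Rightarrow> nat \<Rightarrow> real) set \<Rightarrow> real" where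
  "device_value A uS uR p0 M D =
     (INF \<pi>\<in>D. \<Sum>m\<in>{m\<in>M. 0 < msg_prob p0 \<pi> m}.
        msg_prob p0 \<pi> m * sender_util A uS uR (posterior_set p0 D m) (posterior p0 \<pi> m))"

text \<open>The supremum is taken in \<^typ>\<open>ereal\<close>, where it is meaningful without a boundedness assumption.\<close>

definition optimal_value ::
  "'a::topological_space set \<Rightarrow> ('a \<Rightarrow> 'w \<Rightarrow> real) \<Rightarrow> ('a \<Rightarrow> 'w \<Rightarrow> real)
     \<Rightarrow> real ^ 'w::finite \<Rightarrow> ereal" where
  "optimal_value A uS uR p0 =
     Sup {ereal (device_value A uS uR p0 M D) | M D. ambiguous_device p0 M D}"

definition verifying_selections ::
  "real ^ 'w::finite \<Rightarrow> (real ^ 'w) set pmf \<Rightarrow> ((real ^ 'w) set \<Rightarrow> real ^ 'w) set" where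
  "verifying_selections p0 \<mu> =
     {\<phi>. (\<forall>P\<in>belief_sets. \<phi> P \<in> P) \<and> (\<Sum>P\<in>set_pmf \<mu>. pmf \<mu> P *\<^sub>R \<phi> P) = p0}"

definition verifiably_Bayes_plausible ::
  "real ^ 'w::finite \<Rightarrow> (real ^ 'w) set pmf \<Rightarrow> bool" where
  "verifiably_Bayes_plausible p0 \<mu> \<longleftrightarrow>
     finite (set_pmf \<mu>) \<and> set_pmf \<mu> \<subseteq> belief_sets \<and> verifying_selections p0 \<mu> \<noteq> {}"

definition selection_value ::
  "'a::topological_space set \<Rightarrow> ('a \<Rightarrow> 'w \<Rightarrow> real) \<Rightarrow> ('a \<Rightarrow> 'w \<Rightarrow> real)
     \<Rightarrow> (real ^ 'w::finite) set pmf \<Rightarrow> ((real ^ 'w) set \<Rightarrow> real ^ 'w) \<Rightarrow> real" where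
  "selection_value A uS uR \<mu> \<phi> = (\<Sum>P\<in>set_pmf \<mu>. pmf \<mu> P * sender_util A uS uR P (\<phi> P))"

definition max_selection_value ::
  "'a::topological_space set \<Rightarrow> ('a \<Rightarrow> 'w \<Rightarrow> real) \<Rightarrow> ('a \<Rightarrow> 'w \<Rightarrow> real)
     \<Rightarrow> real ^ 'w::finite \<Rightarrow> (real ^ 'w) set pmf \<Rightarrow> real" where
  "max_selection_value A uS uR p0 \<mu> =
     (SUP \<phi>\<in>verifying_selections p0 \<mu>. selection_value A uS uR \<mu> \<phi>)"

end

theory Submission
  imports Defs
begin

text \<open>
  A strategy of the receiver matters only through the two vectors of state-wise expected utilities,
  and these vectors range over a compact convex set. By the minimax theorem, replacing a set of
  posteriors \<open>P\<close> by the segment from the sender's belief \<open>p \<in> P\<close> to a worst-case belief of \<open>P\<close> only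
  enlarges the receiver's set of best responses. So both problems reduce to concavifying the function
  \<open>max_value p\<close>, the best the sender can get over segments starting at \<open>p\<close>; it is upper
  semicontinuous, hence an optimal splitting of the prior exists. Distinct beliefs can be given
  distinct segments, so the splitting comes from a selection. A device realises it approximately by
  a pair of messages per segment, of which one induces \<open>p\<close> with almost all the weight and the other
  the far end with negligible weight, mixed with the same device with these roles exchanged.
\<close>

subsection \<open>Beliefs and finitely supported distributions\<close>

lemma beliefs_eq: "beliefs = (\<Inter>\<omega>. {p :: real ^ 'w::finite. 0 \<le> p $ \<omega>}) \<inter> {p. (\<Sum>\<omega>\<in>UNIV. p $ \<omega>) = 1}"
  by (auto simp: beliefs_def)

lemma closed_beliefs: "closed (beliefs :: (real ^ 'w::finite) set)"
  unfolding beliefs_eq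
  by (intro closed_Int closed_INT ballI closed_Collect_le closed_Collect_eq continuous_intros)

lemma convex_beliefs: "convex (beliefs :: (real ^ 'w::finite) set)"
  by (rule convexI) (auto simp: beliefs_def sum.distrib sum_distrib_left[symmetric])

lemma norm_beliefs_le: "p \<in> beliefs \<Longrightarrow> norm p \<le> 1" for p :: "real ^ 'w::finite"
  using norm_le_l1_cart[of p] by (auto simp: beliefs_def)

lemma compact_beliefs: "compact (beliefs :: (real ^ 'w::finite) set)"
  unfolding compact_eq_bounded_closed
  using closed_beliefs norm_beliefs_le by (auto simp: bounded_iff)

lemma bounded_subset_beliefs: "P \<subseteq> beliefs \<Longrightarrow> bounded P" for P :: "(real ^ 'w::finite) set"
  using bounded_subset compact_imp_bounded[OF compact_beliefs] by blast

lemma closure_hull_beliefs: "P \<subseteq> beliefs \<Longrightarrow> closure (convex hull P) \<subseteq> beliefs" for P :: "(real ^ 'w::finite) set"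
  by (intro closure_minimal hull_minimal closed_beliefs convex_beliefs)

lemma one_inner_beliefs: "p \<in> beliefs \<Longrightarrow> 1 \<bullet> p = 1" for p :: "real ^ 'w::finite"
  by (simp add: beliefs_def inner_vec_def)

text \<open>The separating functional lies in the cone spanned by \<open>P\<close>; its normalisation is the point sought.\<close>

lemma minimax_beliefs:
  fixes P Y :: "(real ^ 'w::finite) set"
  assumes P: "P \<noteq> {}" "compact P" "convex P" "P \<subseteq> beliefs" and Y: "convex Y"
    and le: "\<And>y. y \<in> Y \<Longrightarrow> \<exists>p\<in>P. y \<bullet> p \<le> v"
  shows "\<exists>p\<in>P. \<forall>y\<in>Y. y \<bullet> p \<le> v"
proof (cases "Y = {}")
  case True
  then show ?thesis using P by auto
next
  case False
  \<comment> \<open>\<open>E\<close> collects the payoff vectors worth more than \<open>v\<close> at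
    every belief in \<open>P\<close>. By \<open>le\<close> it misses \<open>Y\<close>, and it
    contains \<open>r\<close> times the all-ones vector for every \<open>r > v\<close>.\<close>
  define E where "E = {e. \<forall>p\<in>P. v < e \<bullet> p}"
  have one: "1 \<bullet> p = 1" if "p \<in> P" for p
    using that P one_inner_beliefs by blast
  have E_ge: "r *\<^sub>R 1 + z \<in> E" if "v < r" "\<And>p. p \<in> P \<Longrightarrow> 0 \<le> z \<bullet> p" for r z
    unfolding E_def
  proof safe
    fix p assume "p \<in> P"
    then show "v < (r *\<^sub>R 1 + z) \<bullet> p" using that(1) that(2)[of p] by (simp add: inner_add_left one)
  qed
  have "convex E"
  proof -
    have "E = (\<Inter>p\<in>P. {e. v < p \<bullet> e})" by (auto simp: E_def inner_commute)
    then show ?thesis by (auto intro!: convex_INT convex_halfspace_gt)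
  qed
  moreover have "Y \<inter> E = {}" using le by (force simp: E_def)
  moreover have "E \<noteq> {}" using E_ge[of "v + 1" 0] by auto
  ultimately obtain a b where a: "a \<noteq> 0" "\<And>y. y \<in> Y \<Longrightarrow> a \<bullet> y \<le> b" "\<And>e. e \<in> E \<Longrightarrow> b \<le> a \<bullet> e"
    using separating_hyperplane_sets[OF Y, of E] False by metis
  have "a \<in> conic hull P"
  proof (rule ccontr)
    assume "a \<notin> conic hull P"
    moreover have "0 \<notin> P" using one by force
    ultimately obtain z c where z: "z \<bullet> a < c" "\<And>k. k \<in> conic hull P \<Longrightarrow> c < z \<bullet> k"
      using separating_hyperplane_closed_point[of "conic hull P" a]
        convex_conic_hull closed_conic_hull P by metis
    have "c < 0" using z(2)[of 0] P by simp
    have nn: "0 \<le> z \<bullet> p" if "p \<in> P" for p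
    proof (rule ccontr)
      assume neg: "\<not> 0 \<le> z \<bullet> p"
      \<comment> \<open>This rescaling of \<open>p\<close> stays in the cone, but \<open>z\<close>
        takes exactly the value \<open>c\<close> on it, which the strict separation forbids.\<close>
      have "(c / (z \<bullet> p)) *\<^sub>R p \<in> conic hull P"
        using that neg \<open>c < 0\<close> by (auto simp: conic_hull_explicit divide_nonpos_nonpos intro!: exI[of _ "c / (z \<bullet> p)"])
      from z(2)[OF this] neg show False by simp
    qed
    \<comment> \<open>Since \<open>z\<close> is nonnegative on \<open>P\<close>, adding any
      nonnegative multiple of it keeps a point in \<open>E\<close>. This multiple is large enough to
      push the value of \<open>a\<close> down to at most \<open>b - 1\<close>.\<close>
    define k where "k = (max 0 (a \<bullet> ((v+1) *\<^sub>R 1) - b) + 1) / - (z \<bullet> a)"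
    have za: "z \<bullet> a < 0" using z(1) \<open>c < 0\<close> by simp
    then have "0 \<le> k" unfolding k_def by (intro divide_nonneg_pos) auto
    have "(v+1) *\<^sub>R 1 + k *\<^sub>R z \<in> E" using \<open>0 \<le> k\<close> nn by (intro E_ge) auto
    from a(3)[OF this] have "b \<le> a \<bullet> ((v+1) *\<^sub>R 1) + k * (z \<bullet> a)"
      by (simp add: inner_add_right inner_commute)
    also have "k * (z \<bullet> a) = - (max 0 (a \<bullet> ((v+1) *\<^sub>R 1) - b) + 1)" using za by (simp add: k_def)
    finally show False by simp
  qed
  then obtain k p where p: "p \<in> P" "0 \<le> k" "a = k *\<^sub>R p" by (auto simp: conic_hull_explicit)
  then have "0 < k" using a(1) by (cases "k = 0") auto
  \<comment> \<open>The all-ones vector scaled by \<open>v\<close> itself is not in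
    \<open>E\<close>, hence the approximation from above; \<open>a\<close> takes the value
    \<open>k * v + e\<close> on the approximating point.\<close>
  have "b \<le> k * v"
  proof (rule field_le_epsilon)
    fix e :: real assume "0 < e"
    then have "(v + e / k) *\<^sub>R 1 + 0 \<in> E" using \<open>0 < k\<close> by (intro E_ge) auto
    from a(3)[OF this] show "b \<le> k * v + e"
      using one[OF p(1)] \<open>0 < k\<close> p by (simp add: inner_commute algebra_simps)
  qed
  then have "y \<bullet> p \<le> v" if "y \<in> Y" for y
  proof -
    have "k * (y \<bullet> p) \<le> k * v"
      using a(2)[OF that] \<open>b \<le> k * v\<close> p by (simp add: inner_commute)
    then show ?thesis using \<open>0 < k\<close> by simp
  qed
  then show ?thesis using p by blast
qed

section \<open>Convex combinations as barycentres of finitely supported distributions\<close>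

lemma finite_weights_pmf:
  assumes "finite S" "\<And>x. x \<in> S \<Longrightarrow> 0 \<le> w x" "sum w S = 1"
  obtains p where "\<And>x. pmf p x = (if x \<in> S then w x else 0)" "set_pmf p \<subseteq> S"
proof -
  define f where "f x = (if x \<in> S then w x else 0)" for x
  have nn: "0 \<le> f x" for x using assms by (auto simp: f_def)
  have "(\<integral>\<^sup>+ x. ennreal (f x) \<partial>count_space UNIV) = (\<Sum>x\<in>S. ennreal (f x))"
    using assms by (subst nn_integral_count_space'[of S]) (auto simp: f_def)
  also have "\<dots> = ennreal (sum w S)"
    using assms by (subst sum_ennreal) (auto simp: f_def)
  finally have int: "(\<integral>\<^sup>+ x. ennreal (f x) \<partial>count_space UNIV) = 1" using assms by simp
  have "pmf (embed_pmf f) x = f x" for x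
    by (rule pmf_embed_pmf[OF nn int])
  then show thesis
    by (intro that[of "embed_pmf f"]) (auto simp: f_def set_pmf_eq split: if_splits)
qed

lemma convex_hull_pmfE:
  fixes K :: "'b::euclidean_space set"
  assumes "x \<in> convex hull K"
  obtains p where "finite (set_pmf p)" "set_pmf p \<subseteq> K" "measure_pmf.expectation p (\<lambda>z. z) = x"
proof -
  obtain S w where S: "finite S" "S \<subseteq> K" "\<forall>x\<in>S. 0 \<le> w x" "sum w S = 1" "(\<Sum>v\<in>S. w v *\<^sub>R v) = x"
    using assms by (auto simp: convex_hull_explicit)
  obtain p where p: "\<And>x. pmf p x = (if x \<in> S then w x else 0)" "set_pmf p \<subseteq> S"
    using finite_weights_pmf[of S w] S by metis
  have "measure_pmf.expectation p (\<lambda>z. z) = (\<Sum>z\<in>S. pmf p z *\<^sub>R z)"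
    using S p by (intro integral_measure_pmf) auto
  then show thesis using S p by (intro that[of p]) (auto intro: finite_subset)
qed

text \<open>An infimum of linear functions with uniformly bounded gradients is Lipschitz. This
  serves both the receiver's guaranteed utility and, after a change of sign, the sender's
  value.\<close>

lemma continuous_INF_inner:
  fixes X :: "'b::euclidean_space set"
  assumes "X \<noteq> {}" "bounded X"
  shows "continuous_on UNIV (\<lambda>y. INF x\<in>X. y \<bullet> x)"
proof -
  obtain L where L: "0 < L" "\<And>x. x \<in> X \<Longrightarrow> norm x \<le> L"
    using assms(2) bounded_pos by blast
  have bdd: "bdd_below ((\<lambda>x. y \<bullet> x) ` X)" for y
  proof (rule bdd_belowI2)
    fix x assume "x \<in> X"
    then have "\<bar>y \<bullet> x\<bar> \<le> norm y * L"
      using Cauchy_Schwarz_ineq2[of y x] L by (meson mult_left_mono norm_ge_zero order_trans)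
    then show "- (norm y * L) \<le> y \<bullet> x" by linarith
  qed
  have le: "(INF x\<in>X. y \<bullet> x) - L * dist y z \<le> (INF x\<in>X. z \<bullet> x)" for y z
  proof (rule cINF_greatest[OF assms(1)])
    fix x assume x: "x \<in> X"
    have "\<bar>(y - z) \<bullet> x\<bar> \<le> norm (y - z) * L"
      using Cauchy_Schwarz_ineq2[of "y - z" x] L(2)[OF x] by (meson mult_left_mono norm_ge_zero order_trans)
    moreover have "(INF x\<in>X. y \<bullet> x) \<le> y \<bullet> x" using bdd x by (rule cINF_lower)
    ultimately show "(INF x\<in>X. y \<bullet> x) - L * dist y z \<le> z \<bullet> x"
      by (simp add: dist_norm inner_diff_left mult.commute)
  qed
  have "\<bar>(INF x\<in>X. y \<bullet> x) - (INF x\<in>X. z \<bullet> x)\<bar> \<le> L * dist y z" for y z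
    using le[of y z] le[of z y] by (simp add: dist_commute)
  then have "L-lipschitz_on UNIV (\<lambda>y. INF x\<in>X. y \<bullet> x)"
    using L by (intro lipschitz_onI) (auto simp: dist_real_def)
  then show ?thesis by (rule lipschitz_on_continuous_on)
qed

text \<open>Tychonoff's theorem, stated for function types; it is applied to selections, whose index
  set is infinite.\<close>

lemma compact_coordinatewise:
  fixes X :: "'i \<Rightarrow> 'b::topological_space set"
  assumes "\<And>i. compact (X i)"
  shows "compact {f. \<forall>i. f i \<in> X i}"
proof -
  have "compactin (product_topology (\<lambda>i. euclidean) UNIV) (PiE UNIV X)"
    using assms by (simp add: compactin_PiE)
  then show ?thesis by (simp add: euclidean_product_topology PiE_UNIV_domain Pi_def)
qed

lemma expectation_in_convex_hull:
  fixes f :: "'b \<Rightarrow> 'c::euclidean_space"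
  assumes "finite (set_pmf \<nu>)" "\<And>x. x \<in> set_pmf \<nu> \<Longrightarrow> f x \<in> K"
  shows "measure_pmf.expectation \<nu> f \<in> convex hull K"
proof -
  have "measure_pmf.expectation \<nu> f = (\<Sum>x\<in>set_pmf \<nu>. pmf \<nu> x *\<^sub>R f x)"
    using assms by (intro integral_measure_pmf) auto
  also have "\<dots> \<in> convex hull K"
    using assms by (intro convex_sum) (auto simp: sum_pmf_eq_1 hull_inc)
  finally show ?thesis .
qed

lemma belief_setsD:
  assumes "P \<in> belief_sets"
  shows "P \<noteq> {}" "P \<subseteq> beliefs" "compact P"
  using assms closed_Int_compact[of P beliefs] compact_beliefs
  by (auto simp: belief_sets_def inf.absorb1)

subsection \<open>Posteriors\<close>

lemma msg_prob_nonneg: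
  assumes "\<pi> \<in> devices M" "p0 \<in> beliefs"
  shows "0 \<le> msg_prob p0 \<pi> m"
  using assms by (auto simp: msg_prob_def devices_def beliefs_def intro!: sum_nonneg)

lemma sum_msg_prob:
  assumes "\<pi> \<in> devices M" "p0 \<in> beliefs"
  shows "(\<Sum>m\<in>M. msg_prob p0 \<pi> m) = 1"
proof -
  have "(\<Sum>m\<in>M. msg_prob p0 \<pi> m) = (\<Sum>\<omega>\<in>UNIV. p0 $ \<omega> * (\<Sum>m\<in>M. \<pi> \<omega> m))"
    unfolding msg_prob_def by (subst sum.swap) (simp add: sum_distrib_left)
  also have "\<dots> = 1" using assms by (simp add: devices_def beliefs_def)
  finally show ?thesis .
qed

lemma posterior_beliefs:
  assumes "\<pi> \<in> devices M" "p0 \<in> beliefs" "0 < msg_prob p0 \<pi> m"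
  shows "posterior p0 \<pi> m \<in> beliefs"
proof -
  have "(\<Sum>\<omega>\<in>UNIV. posterior p0 \<pi> m $ \<omega>) = msg_prob p0 \<pi> m / msg_prob p0 \<pi> m"
    unfolding sum_divide_distrib msg_prob_def[of p0 \<pi> m]
    by (simp add: posterior_def msg_prob_def mult.commute sum_divide_distrib[symmetric])
  then show ?thesis
    using assms by (auto simp: beliefs_def devices_def posterior_def)
qed

lemma sum_posterior:
  assumes \<pi>: "\<pi> \<in> devices M" and p0: "p0 \<in> beliefs" and M: "finite M"
  shows "(\<Sum>m\<in>{m\<in>M. 0 < msg_prob p0 \<pi> m}. msg_prob p0 \<pi> m *\<^sub>R posterior p0 \<pi> m) = p0"
proof (rule vec_eq_iff[THEN iffD2], rule allI)
  fix \<omega>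
  \<comment> \<open>A message of probability zero has only zero terms in its nonnegative sum, so
    leaving it out loses no mass.\<close>
  have zero: "\<pi> \<omega> m * p0 $ \<omega> = 0" if "\<not> 0 < msg_prob p0 \<pi> m" for m
  proof -
    have "msg_prob p0 \<pi> m = 0" using msg_prob_nonneg[OF \<pi> p0, of m] that by simp
    then show ?thesis
      using \<pi> p0 unfolding msg_prob_def
      by (subst (asm) sum_nonneg_eq_0_iff) (auto simp: devices_def beliefs_def mult.commute)
  qed
  have "(\<Sum>m\<in>{m\<in>M. 0 < msg_prob p0 \<pi> m}. msg_prob p0 \<pi> m *\<^sub>R posterior p0 \<pi> m) $ \<omega> =
      (\<Sum>m\<in>{m\<in>M. 0 < msg_prob p0 \<pi> m}. \<pi> \<omega> m * p0 $ \<omega>)"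
    by (simp add: posterior_def)
  also have "\<dots> = (\<Sum>m\<in>M. \<pi> \<omega> m * p0 $ \<omega>)"
    using M zero by (intro sum.mono_neutral_left) auto
  also have "\<dots> = p0 $ \<omega>"
    using \<pi> by (simp add: sum_distrib_right[symmetric] devices_def)
  finally show "(\<Sum>m\<in>{m\<in>M. 0 < msg_prob p0 \<pi> m}. msg_prob p0 \<pi> m *\<^sub>R posterior p0 \<pi> m) $ \<omega> = p0 $ \<omega>" .
qed

text \<open>Common support is the point: a message that is possible under one member of
  \<open>D\<close> is possible under all, so no posterior in the set divides by zero.\<close>

lemma posterior_set_beliefs:
  assumes D: "ambiguous_device p0 M D" and p0: "p0 \<in> beliefs"
    and \<pi>: "\<pi> \<in> D" and m: "m \<in> M" "0 < msg_prob p0 \<pi> m"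
  shows "posterior_set p0 D m \<subseteq> beliefs" "posterior p0 \<pi> m \<in> posterior_set p0 D m"
proof -
  have "0 < msg_prob p0 \<pi>' m" if "\<pi>' \<in> D" for \<pi>'
    using D \<pi> m that unfolding ambiguous_device_def by blast
  then show "posterior_set p0 D m \<subseteq> beliefs"
    using D posterior_beliefs[OF _ p0] unfolding ambiguous_device_def posterior_set_def by blast
qed (simp add: posterior_set_def \<pi>)

text \<open>Groups the messages of the device constructed below into the pairs that share a
  segment.\<close>

lemma sum_lessThan_double:
  fixes f :: "nat \<Rightarrow> 'b::comm_monoid_add"
  shows "(\<Sum>m<2 * n. f m) = (\<Sum>i<n. f (2 * i) + f (2 * i + 1))"
  by (induction n) (simp_all add: add.assoc)

subsection \<open>Best responses in payoff space\<close>

locale persuasion =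
  fixes A :: "'a::topological_space set"
    and uS uR :: "'a \<Rightarrow> 'w::finite \<Rightarrow> real"
  assumes compact_A: "compact A" and A_nonempty: "A \<noteq> {}"
    and continuous_uS: "\<And>\<omega>. continuous_on A (\<lambda>a. uS a \<omega>)"
    and continuous_uR: "\<And>\<omega>. continuous_on A (\<lambda>a. uR a \<omega>)"
begin

definition util_vec :: "'a \<Rightarrow> (real ^ 'w) \<times> (real ^ 'w)" where
  "util_vec a = (\<chi> \<omega>. uS a \<omega>, \<chi> \<omega>. uR a \<omega>)"

definition payoff :: "'a measure \<Rightarrow> (real ^ 'w) \<times> (real ^ 'w)" where
  "payoff f = (\<integral>a. util_vec a \<partial>f)"

definition payoffs :: "((real ^ 'w) \<times> (real ^ 'w)) set" where
  "payoffs = payoff ` strategies A"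

lemma continuous_util_vec: "continuous_on A util_vec"
  unfolding util_vec_def
  by (intro continuous_intros continuous_on_vec_lambda continuous_uS continuous_uR)

lemma compact_util_vec: "compact (util_vec ` A)"
  using continuous_util_vec compact_A by (rule compact_continuous_image)

lemma strategiesD:
  assumes "f \<in> strategies A"
  shows "prob_space f" "sets f = sets (restrict_space borel A)" "space f = A"
  using assms sets_eq_imp_space_eq[of f "restrict_space borel A"]
  by (auto simp: strategies_def space_prob_algebra space_restrict_space)

lemma integrable_util_vec:
  assumes f: "f \<in> strategies A"
  shows "integrable f util_vec"
proof -
  interpret prob_space f using strategiesD[OF f] by simp
  obtain L where "\<And>a. a \<in> A \<Longrightarrow> norm (util_vec a) \<le> L"
    using compact_imp_bounded[OF compact_util_vec] by (auto simp: bounded_iff)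
  moreover have "util_vec \<in> borel_measurable f"
    using borel_measurable_continuous_on_restrict[OF continuous_util_vec] strategiesD(2)[OF f]
    by (simp cong: measurable_cong_sets)
  ultimately show ?thesis
    using strategiesD(3)[OF f] by (intro integrable_const_bound[where B = L]) (auto intro!: AE_I2)
qed

lemma exp_util_eq:
  assumes f: "f \<in> strategies A"
  shows "exp_util uS f p = fst (payoff f) \<bullet> p" "exp_util uR f p = snd (payoff f) \<bullet> p"
proof -
  have *: "(\<integral>a. c \<bullet> util_vec a \<partial>f) = c \<bullet> payoff f" for c
    unfolding payoff_def using integrable_util_vec[OF f] by simp
  show "exp_util uS f p = fst (payoff f) \<bullet> p"
    using *[of "(p, 0)"]
    by (simp add: exp_util_def util_vec_def inner_prod_def inner_vec_def mult.commute)
  show "exp_util uR f p = snd (payoff f) \<bullet> p"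
    using *[of "(0, p)"]
    by (simp add: exp_util_def util_vec_def inner_prod_def inner_vec_def mult.commute)
qed

text \<open>A half-space containing \<open>util_vec a\<close> for all actions also contains every
  mean, so a mean cannot be separated from the hull. Conversely, a convex combination is realised by
  a finitely supported strategy.\<close>

lemma payoffs_eq_convex_hull: "payoffs = convex hull (util_vec ` A)"
proof (intro equalityI subsetI)
  fix x assume "x \<in> payoffs"
  then obtain f where f: "f \<in> strategies A" "x = payoff f" by (auto simp: payoffs_def)
  interpret prob_space f using strategiesD[OF f(1)] by simp
  show "x \<in> convex hull (util_vec ` A)"
  proof (rule ccontr)
    assume "x \<notin> convex hull (util_vec ` A)"
    then obtain z b where z: "z \<bullet> x < b" "\<And>h. h \<in> convex hull (util_vec ` A) \<Longrightarrow> b < z \<bullet> h"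
      using separating_hyperplane_closed_point[of "convex hull (util_vec ` A)" x]
        compact_imp_closed[OF compact_convex_hull[OF compact_util_vec]] convex_convex_hull by metis
    have "b \<le> (\<integral>a. z \<bullet> util_vec a \<partial>f)"
      using integrable_util_vec[OF f(1)] strategiesD(3)[OF f(1)]
      by (intro integral_ge_const) (auto intro!: AE_I2 less_imp_le z(2) hull_inc)
    also have "\<dots> = z \<bullet> x"
      using integrable_util_vec[OF f(1)] by (simp add: f(2) payoff_def)
    finally show False using z(1) by simp
  qed
next
  fix x assume "x \<in> convex hull (util_vec ` A)"
  then obtain \<nu> where \<nu>: "set_pmf \<nu> \<subseteq> util_vec ` A" "measure_pmf.expectation \<nu> (\<lambda>z. z) = x"
    by (auto elim: convex_hull_pmfE)
  obtain a0 where a0: "a0 \<in> A" using A_nonempty by auto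
  \<comment> \<open>The default \<open>a0\<close> makes \<open>g\<close> map everything into
    \<open>A\<close>; that is all measurability requires, since every set is measurable for a
    pmf.\<close>
  define g where "g z = (if z \<in> util_vec ` A then inv_into A util_vec z else a0)" for z
  define f where "f = distr (measure_pmf \<nu>) (restrict_space borel A) g"
  have g: "g \<in> measurable (measure_pmf \<nu>) (restrict_space borel A)"
    using a0 by (auto simp: g_def space_restrict_space inv_into_into)
  have f: "f \<in> strategies A"
    unfolding strategies_def space_prob_algebra f_def
    using measure_pmf.prob_space_distr[OF g] by simp
  have "payoff f = measure_pmf.expectation \<nu> (\<lambda>z. util_vec (g z))"
    unfolding payoff_def f_def
    using borel_measurable_continuous_on_restrict[OF continuous_util_vec] g
    by (simp add: integral_distr)
  also have "\<dots> = measure_pmf.expectation \<nu> (\<lambda>z. z)"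
    using \<nu>(1) by (intro integral_cong_AE) (auto simp: AE_measure_pmf_iff g_def f_inv_into_f)
  finally show "x \<in> payoffs" using \<nu>(2) f by (auto simp: payoffs_def)
qed

lemma compact_payoffs: "compact payoffs"
  unfolding payoffs_eq_convex_hull using compact_util_vec by (rule compact_convex_hull)

lemma convex_payoffs: "convex payoffs"
  unfolding payoffs_eq_convex_hull by (rule convex_convex_hull)

lemma payoffs_nonempty: "payoffs \<noteq> {}"
  unfolding payoffs_eq_convex_hull using A_nonempty by simp

section \<open>Guaranteed utilities of the receiver and the payoff pairs of best responses\<close>

definition worst :: "(real ^ 'w) set \<Rightarrow> real ^ 'w \<Rightarrow> real" where
  "worst P y = (INF p\<in>P. y \<bullet> p)"

definition best_payoffs :: "(real ^ 'w) set \<Rightarrow> ((real ^ 'w) \<times> (real ^ 'w)) set" where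
  "best_payoffs P = {c \<in> payoffs. \<forall>d\<in>payoffs. worst P (snd d) \<le> worst P (snd c)}"

lemma best_payoffsD: "c \<in> best_payoffs P \<Longrightarrow> c \<in> payoffs"
  by (simp add: best_payoffs_def)

lemma best_responses_eq:
  "best_responses A uR P = {f \<in> strategies A. payoff f \<in> best_payoffs P}"
proof -
  have "(INF p\<in>P. exp_util uR g p) = worst P (snd (payoff g))" if "g \<in> strategies A" for g
    using that by (simp add: worst_def exp_util_eq)
  then show ?thesis
    unfolding best_responses_def is_arg_max_linorder best_payoffs_def payoffs_def by auto
qed

lemma continuous_worst:
  assumes "P \<noteq> {}" "P \<subseteq> beliefs"
  shows "continuous_on X (worst P)"
  using continuous_INF_inner[OF assms(1) bounded_subset_beliefs[OF assms(2)]]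
  unfolding worst_def[abs_def] by (rule continuous_on_subset) simp

lemma worst_le:
  assumes "P \<subseteq> beliefs" "p \<in> P"
  shows "worst P y \<le> y \<bullet> p"
proof -
  have "bdd_below ((\<lambda>p. y \<bullet> p) ` P)"
    using bounded_linear_image[OF bounded_subset_beliefs[OF assms(1)] bounded_linear_inner_right]
    by (rule bounded_imp_bdd_below)
  then show ?thesis unfolding worst_def using assms(2) by (rule cINF_lower)
qed

lemma best_payoffs_nonempty:
  assumes "P \<noteq> {}" "P \<subseteq> beliefs"
  shows "best_payoffs P \<noteq> {}"
proof -
  have "continuous_on payoffs (\<lambda>c. worst P (snd c))"
    by (intro continuous_on_compose2[OF continuous_worst[OF assms, of UNIV]] continuous_intros) auto
  then show ?thesis
    using continuous_attains_sup[OF compact_payoffs payoffs_nonempty] by (fastforce simp: best_payoffs_def)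
qed

lemma compact_best_payoffs:
  assumes "P \<noteq> {}" "P \<subseteq> beliefs"
  shows "compact (best_payoffs P)"
proof -
  have "continuous_on UNIV (\<lambda>c::(real^'w) \<times> (real^'w). worst P (snd c))"
    by (intro continuous_on_compose2[OF continuous_worst[OF assms, of UNIV]] continuous_intros) auto
  then have "closed (\<Inter>d\<in>payoffs. {c :: (real ^ 'w) \<times> (real ^ 'w). worst P (snd d) \<le> worst P (snd c)})"
    by (intro closed_INT ballI closed_Collect_le continuous_on_const) auto
  moreover have "best_payoffs P = payoffs \<inter> (\<Inter>d\<in>payoffs. {c. worst P (snd d) \<le> worst P (snd c)})"
    by (auto simp: best_payoffs_def)
  ultimately show ?thesis using compact_payoffs by (simp add: compact_Int_closed)
qed

definition sender_value :: "(real ^ 'w) set \<Rightarrow> real ^ 'w \<Rightarrow> real" where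
  "sender_value P p = (SUP c\<in>best_payoffs P. fst c \<bullet> p)"

lemma sender_value_ge:
  assumes "c \<in> best_payoffs P"
  shows "fst c \<bullet> p \<le> sender_value P p"
proof -
  have "bounded (best_payoffs P)"
    using compact_imp_bounded[OF compact_payoffs] by (rule bounded_subset) (auto simp: best_payoffs_def)
  then have "bounded ((\<lambda>c. fst c \<bullet> p) ` best_payoffs P)"
    using bounded_linear_image
      bounded_linear_compose[OF bounded_linear_inner_left bounded_linear_fst, of p] by blast
  then show ?thesis
    unfolding sender_value_def using assms by (intro cSUP_upper bounded_imp_bdd_above)
qed

lemma sender_value_attained:
  assumes "P \<noteq> {}" "P \<subseteq> beliefs"
  obtains c where "c \<in> best_payoffs P" "sender_value P p = fst c \<bullet> p"
proof -
  have "continuous_on (best_payoffs P) (\<lambda>c. fst c \<bullet> p)" by (intro continuous_intros)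
  then obtain c where c: "c \<in> best_payoffs P" "\<And>d. d \<in> best_payoffs P \<Longrightarrow> fst d \<bullet> p \<le> fst c \<bullet> p"
    using continuous_attains_sup[OF compact_best_payoffs[OF assms] best_payoffs_nonempty[OF assms]]
    by blast
  then have "sender_value P p = fst c \<bullet> p"
    unfolding sender_value_def by (intro cSup_eq_maximum) auto
  then show thesis using c that by blast
qed

text \<open>\<open>preferred_response\<close> is a choice among maximisers, so a maximiser must be
  exhibited first; compactness of \<open>best_payoffs P\<close> supplies one. All maximisers give
  the sender the same utility.\<close>

lemma sender_util_eq:
  assumes "P \<noteq> {}" "P \<subseteq> beliefs"
  shows "sender_util A uS uR P p = sender_value P p"
proof -
  let ?max = "is_arg_max (\<lambda>f. exp_util uS f p) (\<lambda>f. f \<in> best_responses A uR P)"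
  have iff: "?max f \<longleftrightarrow> f \<in> strategies A \<and> payoff f \<in> best_payoffs P \<and>
      (\<forall>d\<in>best_payoffs P. fst d \<bullet> p \<le> fst (payoff f) \<bullet> p)" for f
  proof -
    have "(\<forall>d\<in>best_payoffs P. fst d \<bullet> p \<le> r) \<longleftrightarrow>
      (\<forall>g\<in>strategies A. payoff g \<in> best_payoffs P \<longrightarrow> fst (payoff g) \<bullet> p \<le> r)" for r
      unfolding best_payoffs_def payoffs_def by blast
    then show ?thesis
      by (auto simp: is_arg_max_linorder best_responses_eq exp_util_eq)
  qed
  obtain c where c: "c \<in> best_payoffs P" "sender_value P p = fst c \<bullet> p"
    using sender_value_attained[OF assms] .
  then obtain f where "f \<in> strategies A" "c = payoff f"
    unfolding best_payoffs_def payoffs_def by blast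
  with c have "?max f"
    using sender_value_ge[of _ P p] by (auto simp: iff)
  then have "?max (preferred_response A uS uR p P)"
    unfolding preferred_response_def arg_max_def by (rule someI)
  then have "sender_util A uS uR P p = fst (payoff (preferred_response A uS uR p P)) \<bullet> p"
    "fst c \<bullet> p \<le> fst (payoff (preferred_response A uS uR p P)) \<bullet> p"
    "payoff (preferred_response A uS uR p P) \<in> best_payoffs P"
    using c(1) by (auto simp: iff sender_util_def exp_util_eq)
  then show ?thesis
    using sender_value_ge[of _ P p] c(2) by (simp add: order_antisym)
qed

text \<open>For fixed \<open>P\<close> this is a supremum of linear functions of the belief;
  negating the payoffs turns it into an infimum.\<close>

lemma continuous_sender_value:
  assumes "P \<noteq> {}" "P \<subseteq> beliefs"
  shows "continuous_on X (sender_value P)"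
proof -
  let ?X = "(\<lambda>c. - fst c) ` best_payoffs P"
  have "bounded ?X"
    using compact_best_payoffs[OF assms]
    by (intro compact_imp_bounded compact_continuous_image continuous_intros)
  then have "continuous_on UNIV (\<lambda>p. INF x\<in>?X. p \<bullet> x)"
    using best_payoffs_nonempty[OF assms] by (intro continuous_INF_inner) auto
  moreover have "sender_value P p = - (INF x\<in>?X. p \<bullet> x)" for p
    by (simp add: sender_value_def Inf_real_def image_image inner_commute)
  ultimately show ?thesis
    unfolding continuous_on_minus[of UNIV]
    by (auto intro: continuous_on_minus continuous_on_subset)
qed

subsection \<open>Optimal splittings of the prior\<close>

text \<open>A linear function on a segment is minimised at an end. Allowing any set between the two
  ends and the segment covers pairs, full segments and the posterior sets of the device built
  below.\<close>

lemma worst_pair: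
  assumes "{p, q} \<subseteq> P" "P \<subseteq> closed_segment p q"
  shows "worst P y = min (y \<bullet> p) (y \<bullet> q)"
  unfolding worst_def
proof (rule cInf_eq_minimum)
  show "min (y \<bullet> p) (y \<bullet> q) \<in> (\<lambda>p. y \<bullet> p) ` P"
    using assms(1) by (auto simp: min_def)
  have "closed_segment p q \<subseteq> {x. min (y \<bullet> p) (y \<bullet> q) \<le> y \<bullet> x}"
    unfolding segment_convex_hull
    by (rule hull_minimal) (use convex_halfspace_ge[of "min (y \<bullet> p) (y \<bullet> q)" y] in auto)
  then show "min (y \<bullet> p) (y \<bullet> q) \<le> r" if "r \<in> (\<lambda>p. y \<bullet> p) ` P" for r
    using that assms(2) by auto
qed

lemma worst_doubleton: "worst {p, q} y = min (y \<bullet> p) (y \<bullet> q)"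
  by (rule worst_pair) auto

lemma best_payoffs_pair:
  assumes "{p, q} \<subseteq> P" "P \<subseteq> closed_segment p q"
  shows "best_payoffs P = best_payoffs {p, q}"
  unfolding best_payoffs_def worst_pair[OF assms] worst_doubleton by (rule refl)

text \<open>Minimax needs a compact convex set of beliefs; passing to the closed hull does not lower
  the guarantee, because closed half-spaces are preserved.\<close>

lemma worst_le_closure_hull:
  assumes "P \<subseteq> beliefs" "p \<in> closure (convex hull P)"
  shows "worst P y \<le> y \<bullet> p"
proof -
  have "convex hull P \<subseteq> {x. worst P y \<le> y \<bullet> x}"
    by (rule hull_minimal) (use worst_le[OF assms(1)] convex_halfspace_ge in auto)
  then have "closure (convex hull P) \<subseteq> {x. worst P y \<le> y \<bullet> x}"
    by (rule closure_minimal) (rule closed_halfspace_ge)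
  then show ?thesis using assms(2) by auto
qed

text \<open>The belief \<open>r\<close> is the minimising player's optimal choice in the zero-sum game between a belief
  and a strategy of the receiver. It alone already pins down the receiver's guaranteed utility.\<close>

lemma worst_case_belief:
  assumes P: "P \<noteq> {}" "P \<subseteq> beliefs"
  shows "\<exists>r\<in>closure (convex hull P). \<forall>p\<in>closure (convex hull P). best_payoffs P \<subseteq> best_payoffs {p, r}"
proof -
  let ?Q = "closure (convex hull P)"
  have Q: "?Q \<noteq> {}" "?Q \<subseteq> beliefs" "compact ?Q" "convex ?Q"
    using P closure_hull_beliefs[OF P(2)] bounded_convex_hull[OF bounded_subset_beliefs[OF P(2)]]
    by (simp_all add: compact_closure convex_closure)
  obtain c0 where c0: "c0 \<in> best_payoffs P" using best_payoffs_nonempty[OF P] by blast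
  let ?v = "worst P (snd c0)"
  \<comment> \<open>This is the hypothesis of \<open>minimax_beliefs\<close>: no strategy guarantees
    the receiver more than the optimal level \<open>?v\<close>.\<close>
  have "\<exists>p\<in>?Q. y \<bullet> p \<le> ?v" if "y \<in> snd ` payoffs" for y
  proof -
    have "continuous_on ?Q (\<lambda>p. y \<bullet> p)" by (intro continuous_intros)
    then obtain p where p: "p \<in> ?Q" "\<And>q. q \<in> ?Q \<Longrightarrow> y \<bullet> p \<le> y \<bullet> q"
      using continuous_attains_inf[OF Q(3,1)] by blast
    have "y \<bullet> p \<le> worst P y"
      unfolding worst_def using P(1) p(2) hull_subset[of P] closure_subset[of "convex hull P"]
      by (intro cINF_greatest) auto
    also have "\<dots> \<le> ?v" using that c0 by (auto simp: best_payoffs_def)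
    finally show ?thesis using p(1) by blast
  qed
  moreover have "convex (snd ` payoffs)"
    using convex_payoffs linear_snd by (rule convex_linear_image[rotated])
  ultimately obtain r where r: "r \<in> ?Q" "\<And>d. d \<in> payoffs \<Longrightarrow> snd d \<bullet> r \<le> ?v"
    using minimax_beliefs[of ?Q "snd ` payoffs" ?v] Q by blast
  \<comment> \<open>Against \<open>{p, r}\<close> the pair \<open>c\<close> still guarantees
    \<open>?v\<close>, while at \<open>r\<close> alone no strategy yields more than
    \<open>?v\<close>.\<close>
  have "c \<in> best_payoffs {p, r}" if "p \<in> ?Q" "c \<in> best_payoffs P" for p c
  proof -
    have "?v \<le> worst P (snd c)" using that(2) c0 by (auto simp: best_payoffs_def)
    then have "?v \<le> min (snd c \<bullet> p) (snd c \<bullet> r)"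
      using worst_le_closure_hull[OF P(2)] that(1) r(1) by (meson min.boundedI order_trans)
    then show ?thesis
      using r(2) that(2) unfolding best_payoffs_def worst_doubleton by (fastforce simp: min_le_iff_disj)
  qed
  then show ?thesis using r(1) by blast
qed

lemma sender_value_mono:
  assumes "P \<noteq> {}" "P \<subseteq> beliefs" "best_payoffs P \<subseteq> best_payoffs Q"
  shows "sender_value P p \<le> sender_value Q p"
proof -
  obtain c where "c \<in> best_payoffs P" "sender_value P p = fst c \<bullet> p"
    using sender_value_attained[OF assms(1,2)] .
  then show ?thesis using sender_value_ge[of c Q p] assms(3) by auto
qed

section \<open>Optimal segments starting at a given belief\<close>

definition best_response_graph :: "((real ^ 'w) \<times> (real ^ 'w) \<times> (real ^ 'w) \<times> (real ^ 'w)) set" where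
  "best_response_graph = {(p, q, c). p \<in> beliefs \<and> q \<in> beliefs \<and> c \<in> best_payoffs {p, q}}"

text \<open>Being a best response to \<open>{p, q}\<close> is an intersection of inequalities, one
  per competing payoff, each jointly continuous in both beliefs and the payoff. This is where upper
  semicontinuity comes from.\<close>

lemma compact_best_response_graph: "compact best_response_graph"
proof -
  let ?le = "\<lambda>d. {(p :: real ^ 'w, q, c :: (real ^ 'w) \<times> (real ^ 'w)).
      min (snd d \<bullet> p) (snd d \<bullet> q) \<le> min (snd c \<bullet> p) (snd c \<bullet> q)}"
  have "best_response_graph = (beliefs \<times> beliefs \<times> payoffs) \<inter> (\<Inter>d\<in>payoffs. ?le d)"
    by (auto simp: best_response_graph_def best_payoffs_def worst_doubleton)
  moreover have "closed (?le d)" for d :: "(real ^ 'w) \<times> (real ^ 'w)"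
    unfolding case_prod_unfold by (intro closed_Collect_le continuous_intros)
  ultimately show ?thesis
    by (auto intro!: compact_Int_closed compact_Times compact_beliefs compact_payoffs closed_INT)
qed

text \<open>Among the optimal partners of \<open>p\<close> the nearest one is chosen, which makes
  \<open>p \<mapsto> closed_segment p (partner p)\<close> injective.\<close>

definition is_partner :: "real ^ 'w \<Rightarrow> real ^ 'w \<Rightarrow> bool" where
  "is_partner p q \<longleftrightarrow> q \<in> beliefs \<and>
     (\<forall>r\<in>beliefs. sender_value {p, r} p \<le> sender_value {p, q} p) \<and>
     (\<forall>r\<in>beliefs. sender_value {p, q} p \<le> sender_value {p, r} p \<longrightarrow> dist p q \<le> dist p r)"

definition partner :: "real ^ 'w \<Rightarrow> real ^ 'w" where
  "partner p = (SOME q. is_partner p q)"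

text \<open>Two successive optimisations over compact sets: first the sender's payoff at
  \<open>p\<close> is maximised, then the distance to \<open>p\<close> is minimised among the
  maximisers.\<close>

lemma is_partner_partner:
  assumes p: "p \<in> beliefs"
  shows "is_partner p (partner p)"
proof -
  \<comment> \<open>The payoff is kept beside the partner, so that the objective is continuous
    although \<open>sender_value\<close> is only a supremum over payoffs.\<close>
  let ?G = "{(q, c). q \<in> beliefs \<and> c \<in> best_payoffs {p, q}}"
  have "?G = snd ` (best_response_graph \<inter> {z. fst z = p})"
    using p by (force simp: best_response_graph_def)
  moreover have "closed {z :: (real ^ 'w) \<times> (real ^ 'w) \<times> (real ^ 'w) \<times> (real ^ 'w). fst z = p}"
    by (intro closed_Collect_eq continuous_intros)
  ultimately have G: "compact ?G"
    by (auto intro!: compact_continuous_image compact_Int_closed compact_best_response_graph continuous_intros)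
  have "?G \<noteq> {}" using best_payoffs_nonempty[of "{p}"] p by auto
  moreover have "continuous_on ?G (\<lambda>z. fst (snd z) \<bullet> p)" by (intro continuous_intros)
  ultimately obtain z0 where z0: "z0 \<in> ?G" "\<And>z. z \<in> ?G \<Longrightarrow> fst (snd z) \<bullet> p \<le> fst (snd z0) \<bullet> p"
    using continuous_attains_sup[OF G] by blast
  define t where "t = fst (snd z0) \<bullet> p"
  have t_ge: "fst c \<bullet> p \<le> t" if "q \<in> beliefs" "c \<in> best_payoffs {p, q}" for q c
    using z0(2)[of "(q, c)"] that by (simp add: t_def)
  let ?H = "?G \<inter> {z. fst (snd z) \<bullet> p = t}"
  have "compact ?H"
    by (intro compact_Int_closed G closed_Collect_eq continuous_intros)
  moreover have "?H \<noteq> {}" using z0(1) by (auto simp: t_def)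
  moreover have "continuous_on ?H (\<lambda>z. dist p (fst z))" by (intro continuous_intros)
  ultimately have "\<exists>z1\<in>?H. \<forall>z\<in>?H. dist p (fst z1) \<le> dist p (fst z)"
    by (rule continuous_attains_inf)
  then obtain z1 where z1: "z1 \<in> ?H" "\<And>z. z \<in> ?H \<Longrightarrow> dist p (fst z1) \<le> dist p (fst z)"
    by blast
  obtain q c where qc: "z1 = (q, c)" by (cases z1)
  have le_t: "sender_value {p, r} p \<le> t" if r: "r \<in> beliefs" for r
  proof -
    obtain d where "d \<in> best_payoffs {p, r}" "sender_value {p, r} p = fst d \<bullet> p"
      using sender_value_attained[of "{p, r}" p] p r by auto
    then show ?thesis using t_ge[OF r] by simp
  qed
  have "t \<le> sender_value {p, q} p" using z1(1) sender_value_ge[of c "{p, q}" p] by (auto simp: qc)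
  moreover have "dist p q \<le> dist p r" if r: "r \<in> beliefs" "t \<le> sender_value {p, r} p" for r
  proof -
    obtain d where "d \<in> best_payoffs {p, r}" "sender_value {p, r} p = fst d \<bullet> p"
      using sender_value_attained[of "{p, r}" p] p r by auto
    then have "(r, d) \<in> ?H" using le_t[OF r(1)] r by auto
    from z1(2)[OF this] show ?thesis by (simp add: qc)
  qed
  moreover have "q \<in> beliefs" using z1(1) by (auto simp: qc)
  ultimately have "is_partner p q"
    unfolding is_partner_def using le_t by (meson order_trans)
  then show ?thesis unfolding partner_def by (rule someI)
qed

definition max_value :: "real ^ 'w \<Rightarrow> real" where
  "max_value p = sender_value {p, partner p} p"

lemma partner_in_beliefs: "p \<in> beliefs \<Longrightarrow> partner p \<in> beliefs"
  using is_partner_partner by (auto simp: is_partner_def)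

text \<open>The segment from \<open>p\<close> to the worst-case belief keeps all best responses to
  \<open>P\<close>, and the partner of \<open>p\<close> does at least as well as that
  belief.\<close>

lemma sender_value_le_max_value:
  assumes "P \<noteq> {}" "P \<subseteq> beliefs" "p \<in> P"
  shows "sender_value P p \<le> max_value p"
proof -
  obtain r where r: "r \<in> closure (convex hull P)"
    "\<forall>p\<in>closure (convex hull P). best_payoffs P \<subseteq> best_payoffs {p, r}"
    using worst_case_belief[OF assms(1,2)] by blast
  have "p \<in> closure (convex hull P)"
    using assms(3) hull_subset[of P] closure_subset[of "convex hull P"] by auto
  then have "sender_value P p \<le> sender_value {p, r} p"
    using r(2) by (intro sender_value_mono[OF assms(1,2)]) auto
  also have "\<dots> \<le> max_value p"
    using is_partner_partner[of p] assms(2,3) r(1) closure_hull_beliefs[OF assms(2)]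
    unfolding is_partner_def max_value_def by auto
  finally show ?thesis .
qed

lemma sender_value_segment: "sender_value (closed_segment p q) x = sender_value {p, q} x"
  unfolding sender_value_def by (subst best_payoffs_pair[of p q]) auto

text \<open>Two distinct beliefs with a common segment would be partners of each other. The
  worst-case belief on the segment is an equally good partner for both, so it would have to be at
  least the full length away from both ends.\<close>

lemma inj_on_partner_segment: "inj_on (\<lambda>p. closed_segment p (partner p)) beliefs"
proof (rule inj_onI, rule ccontr)
  fix a b assume ab: "a \<in> beliefs" "b \<in> beliefs" "a \<noteq> b"
    and "closed_segment a (partner a) = closed_segment b (partner b)"
  then have partners: "partner a = b" "partner b = a"
    by (auto simp: closed_segment_eq doubleton_eq_iff)
  let ?P = "{a, b}"
  have P: "?P \<noteq> {}" "?P \<subseteq> beliefs" using ab by auto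
  have hull: "closure (convex hull ?P) = closed_segment a b"
    by (simp add: segment_convex_hull[symmetric])
  obtain r where r: "r \<in> closed_segment a b"
    "\<And>p. p \<in> closed_segment a b \<Longrightarrow> best_payoffs ?P \<subseteq> best_payoffs {p, r}"
    using worst_case_belief[OF P] unfolding hull by blast
  have rb: "r \<in> beliefs"
    using r(1) closure_hull_beliefs[OF P(2)] unfolding hull by blast
  have "sender_value ?P p \<le> sender_value {p, r} p" if "p \<in> {a, b}" for p
    using that by (intro sender_value_mono[OF P] r(2)) auto
  then have "dist a b \<le> dist a r" "dist b a \<le> dist b r"
    using is_partner_partner[OF ab(1)] is_partner_partner[OF ab(2)] rb
    unfolding is_partner_def partners by (auto simp: insert_commute)
  moreover have "dist a b = dist a r + dist r b"
    using r(1) between_mem_segment between by metis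
  ultimately show False using ab(3) by (simp add: dist_commute)
qed

text \<open>Only part of the usual hypograph: it contains the graph of \<open>max_value\<close> and
  lies below it, yet it is compact.\<close>

definition hypograph :: "((real ^ 'w) \<times> real) set" where
  "hypograph = (\<lambda>(p, q, c). (p, fst c \<bullet> p)) ` best_response_graph"

lemma compact_hypograph: "compact hypograph"
  unfolding hypograph_def case_prod_unfold
  by (intro compact_continuous_image compact_best_response_graph continuous_intros)

lemma hypograph_le: "z \<in> hypograph \<Longrightarrow> fst z \<in> beliefs \<and> snd z \<le> max_value (fst z)"
proof -
  assume "z \<in> hypograph"
  then obtain p q c where z: "z = (p, fst c \<bullet> p)" "p \<in> beliefs" "q \<in> beliefs" "c \<in> best_payoffs {p, q}"
    by (auto simp: hypograph_def best_response_graph_def)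
  then have "fst c \<bullet> p \<le> max_value p"
    using sender_value_ge[of c "{p, q}" p] sender_value_le_max_value[of "{p, q}" p] by simp
  with z show ?thesis by simp
qed

lemma max_value_hypograph:
  assumes "p \<in> beliefs"
  shows "(p, max_value p) \<in> hypograph"
proof -
  obtain c where "c \<in> best_payoffs {p, partner p}" "max_value p = fst c \<bullet> p"
    using sender_value_attained[of "{p, partner p}" p] assms partner_in_beliefs
    unfolding max_value_def by auto
  then show ?thesis
    using assms partner_in_beliefs by (force simp: hypograph_def best_response_graph_def)
qed

section \<open>Concavification of \<open>max_value\<close>\<close>

definition splits :: "real ^ 'w \<Rightarrow> (real ^ 'w) pmf \<Rightarrow> bool" where
  "splits p0 \<nu> \<longleftrightarrow> finite (set_pmf \<nu>) \<and> set_pmf \<nu> \<subseteq> beliefs \<and> measure_pmf.expectation \<nu> (\<lambda>p. p) = p0"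

text \<open>The concave envelope at \<open>p0\<close> is the height of the convex hull of
  \<open>hypograph\<close> above \<open>p0\<close>. The hull is compact, so the top is
  attained.\<close>

lemma optimal_split:
  assumes p0: "p0 \<in> beliefs"
  shows "\<exists>\<nu>. is_arg_max (\<lambda>\<nu>. measure_pmf.expectation \<nu> max_value) (splits p0) \<nu>"
proof -
  let ?K = "convex hull hypograph \<inter> {z. fst z = p0}"
  have "compact ?K"
    by (intro compact_Int_closed compact_convex_hull compact_hypograph closed_Collect_eq continuous_intros)
  moreover have "?K \<noteq> {}" using hull_inc[OF max_value_hypograph[OF p0]] by fastforce
  moreover have "continuous_on ?K snd" by (intro continuous_intros)
  ultimately have "\<exists>z\<in>?K. \<forall>y\<in>?K. snd y \<le> snd z"
    by (rule continuous_attains_sup)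
  then obtain z where z: "z \<in> ?K" "\<And>y. y \<in> ?K \<Longrightarrow> snd y \<le> snd z"
    by blast
  obtain \<rho> where \<rho>: "finite (set_pmf \<rho>)" "set_pmf \<rho> \<subseteq> hypograph" "measure_pmf.expectation \<rho> (\<lambda>z. z) = z"
    using z(1) by (auto elim: convex_hull_pmfE)
  have int: "integrable (measure_pmf \<rho>) f" for f :: "_ \<Rightarrow> 'c::{banach, second_countable_topology}"
    using \<rho>(1) by (rule integrable_measure_pmf_finite)
  \<comment> \<open>Dropping the heights may merge points, but replacing each height by
    \<open>max_value\<close> only raises the mean.\<close>
  define \<nu> where "\<nu> = map_pmf fst \<rho>"
  have "measure_pmf.expectation \<nu> (\<lambda>p. p) = fst z"
    unfolding \<nu>_def \<rho>(3)[symmetric] integral_map_pmf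
    by (rule integral_bounded_linear[OF bounded_linear_fst int])
  then have \<nu>: "splits p0 \<nu>"
    using z(1) \<rho>(1,2) hypograph_le by (auto simp: splits_def \<nu>_def)
  have "snd z = measure_pmf.expectation \<rho> snd"
    unfolding \<rho>(3)[symmetric]
    by (rule integral_bounded_linear[OF bounded_linear_snd int, symmetric])
  also have "\<dots> \<le> measure_pmf.expectation \<nu> max_value"
    unfolding \<nu>_def integral_map_pmf using \<rho>(2) hypograph_le
    by (intro integral_mono_AE int) (auto simp: AE_measure_pmf_iff)
  finally have "snd z \<le> measure_pmf.expectation \<nu> max_value" .
  moreover have "measure_pmf.expectation \<nu>' max_value \<le> snd z" if \<nu>': "splits p0 \<nu>'" for \<nu>'
  proof -
    have int: "integrable (measure_pmf \<nu>') f" for f :: "_ \<Rightarrow> 'c::{banach, second_countable_topology}"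
      using \<nu>' unfolding splits_def by (intro integrable_measure_pmf_finite) auto
    let ?e = "measure_pmf.expectation \<nu>' (\<lambda>p. (p, max_value p))"
    have "fst ?e = p0"
      using integral_bounded_linear[OF bounded_linear_fst int, of "\<lambda>p. (p, max_value p)"] \<nu>'
      by (simp add: splits_def)
    moreover have "snd ?e = measure_pmf.expectation \<nu>' max_value"
      using integral_bounded_linear[OF bounded_linear_snd int, of "\<lambda>p. (p, max_value p)"] by simp
    moreover have "?e \<in> convex hull hypograph"
      using \<nu>' by (intro expectation_in_convex_hull max_value_hypograph) (auto simp: splits_def)
    ultimately show ?thesis using z(2)[of ?e] by simp
  qed
  ultimately show ?thesis
    using \<nu> unfolding is_arg_max_linorder by (meson order_trans)
qed

subsection \<open>Selections\<close>

lemma selection_value_eq: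
  assumes "set_pmf \<mu> \<subseteq> belief_sets"
  shows "selection_value A uS uR \<mu> \<phi> = (\<Sum>P\<in>set_pmf \<mu>. pmf \<mu> P * sender_value P (\<phi> P))"
  unfolding selection_value_def
proof (rule sum.cong[OF refl])
  fix P assume "P \<in> set_pmf \<mu>"
  then have "P \<in> belief_sets" using assms by blast
  from sender_util_eq[OF belief_setsD(1,2)[OF this]]
  show "pmf \<mu> P * sender_util A uS uR P (\<phi> P) = pmf \<mu> P * sender_value P (\<phi> P)" by simp
qed

text \<open>Maximises a continuous function over a compact set of selections in the product
  topology.\<close>

lemma optimal_selection:
  assumes \<mu>: "verifiably_Bayes_plausible p0 \<mu>"
  shows "\<exists>\<phi>. is_arg_max (selection_value A uS uR \<mu>) (\<lambda>\<phi>. \<phi> \<in> verifying_selections p0 \<mu>) \<phi>"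
proof -
  let ?v = "\<lambda>\<phi>. \<Sum>P\<in>set_pmf \<mu>. pmf \<mu> P * sender_value P (\<phi> P)"
  \<comment> \<open>A verifying selection is unconstrained outside \<open>belief_sets\<close>;
    pinning it to 0 there yields a product of compact sets. The map \<open>cut\<close> does this
    without changing the values on the support.\<close>
  define F where "F = {\<phi>. \<forall>P. \<phi> P \<in> (if P \<in> belief_sets then P else {0 :: real ^ 'w})}"
  let ?F = "F \<inter> {\<phi>. (\<Sum>P\<in>set_pmf \<mu>. pmf \<mu> P *\<^sub>R \<phi> P) = p0}"
  define cut where "cut \<phi> P = (if P \<in> belief_sets then \<phi> P else (0 :: real ^ 'w))"
    for \<phi> and P :: "(real ^ 'w) set"
  have supp: "finite (set_pmf \<mu>)" "set_pmf \<mu> \<subseteq> belief_sets"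
    using \<mu> by (auto simp: verifiably_Bayes_plausible_def)
  have coord: "continuous_on X (\<lambda>\<phi> :: (real ^ 'w) set \<Rightarrow> real ^ 'w. \<phi> P)" for X P
    by (rule continuous_on_subset[OF continuous_on_product_coordinates]) simp
  have cut_eq: "cut \<phi> P = \<phi> P" if "P \<in> set_pmf \<mu>" for \<phi> P
    using that supp by (auto simp: cut_def)
  have cut: "cut \<phi> \<in> ?F" if "\<phi> \<in> verifying_selections p0 \<mu>" for \<phi>
  proof
    show "cut \<phi> \<in> F"
      using that by (simp add: F_def cut_def verifying_selections_def)
    show "cut \<phi> \<in> {\<phi>. (\<Sum>P\<in>set_pmf \<mu>. pmf \<mu> P *\<^sub>R \<phi> P) = p0}"
      using that by (simp add: cut_eq verifying_selections_def)
  qed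
  have "compact F"
    unfolding F_def by (rule compact_coordinatewise) (auto intro: belief_setsD)
  moreover have "continuous_on UNIV (\<lambda>\<phi>. \<Sum>P\<in>set_pmf \<mu>. pmf \<mu> P *\<^sub>R (\<phi> P :: real ^ 'w))"
    by (intro continuous_on_sum continuous_on_scaleR continuous_on_const coord)
  ultimately have "compact ?F"
    by (intro compact_Int_closed closed_Collect_eq continuous_on_const)
  moreover have "?F \<noteq> {}" using \<mu> cut by (auto simp: verifiably_Bayes_plausible_def)
  moreover have "continuous_on ?F ?v"
  proof (intro continuous_on_sum continuous_on_mult continuous_on_const)
    fix P assume "P \<in> set_pmf \<mu>"
    then have "P \<in> belief_sets" using supp by blast
    from continuous_on_compose2[OF continuous_sender_value[OF belief_setsD(1,2)[OF this], of UNIV] coord[of ?F P]]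
    show "continuous_on ?F (\<lambda>\<phi>. sender_value P (\<phi> P))" by simp
  qed
  ultimately have "\<exists>\<phi>\<in>?F. \<forall>\<psi>\<in>?F. ?v \<psi> \<le> ?v \<phi>"
    by (rule continuous_attains_sup)
  then obtain \<phi> where \<phi>: "\<phi> \<in> ?F" "\<And>\<psi>. \<psi> \<in> ?F \<Longrightarrow> ?v \<psi> \<le> ?v \<phi>" by blast
  have "\<phi> P \<in> P" if "P \<in> belief_sets" for P
  proof -
    have "\<phi> P \<in> (if P \<in> belief_sets then P else {0})"
      using \<phi>(1) unfolding F_def by blast
    then show ?thesis using that by simp
  qed
  then have "\<phi> \<in> verifying_selections p0 \<mu>"
    using \<phi>(1) by (simp add: verifying_selections_def)
  moreover have "?v \<psi> \<le> ?v \<phi>" if "\<psi> \<in> verifying_selections p0 \<mu>" for \<psi>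
    using \<phi>(2)[OF cut[OF that]] by (simp add: cut_eq)
  ultimately show ?thesis
    unfolding is_arg_max_linorder selection_value_eq[OF supp(2)] by blast
qed

text \<open>The image of \<open>\<mu>\<close> under the selection is itself a splitting of the
  prior, and each term is bounded by \<open>max_value\<close>.\<close>

lemma selection_value_le:
  assumes \<mu>: "verifiably_Bayes_plausible p0 \<mu>" and \<phi>: "\<phi> \<in> verifying_selections p0 \<mu>"
    and \<nu>: "is_arg_max (\<lambda>\<nu>. measure_pmf.expectation \<nu> max_value) (splits p0) \<nu>"
  shows "selection_value A uS uR \<mu> \<phi> \<le> measure_pmf.expectation \<nu> max_value"
proof -
  have supp: "finite (set_pmf \<mu>)" "set_pmf \<mu> \<subseteq> belief_sets"
    using \<mu> by (auto simp: verifiably_Bayes_plausible_def)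
  have mem: "\<phi> P \<in> P" "P \<noteq> {}" "P \<subseteq> beliefs" if "P \<in> set_pmf \<mu>" for P
    using that supp \<phi> belief_setsD by (auto simp: verifying_selections_def)
  have "measure_pmf.expectation \<mu> \<phi> = p0"
    using \<phi> supp(1) by (subst integral_measure_pmf[of "set_pmf \<mu>"]) (auto simp: verifying_selections_def)
  then have "splits p0 (map_pmf \<phi> \<mu>)"
    using supp(1) mem by (auto simp: splits_def)
  have "selection_value A uS uR \<mu> \<phi> \<le> (\<Sum>P\<in>set_pmf \<mu>. pmf \<mu> P * max_value (\<phi> P))"
    unfolding selection_value_eq[OF supp(2)]
    by (intro sum_mono mult_left_mono sender_value_le_max_value mem) auto
  also have "\<dots> = measure_pmf.expectation (map_pmf \<phi> \<mu>) max_value"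
    using supp(1) by (simp add: integral_measure_pmf[of "set_pmf \<mu>"])
  also have "\<dots> \<le> measure_pmf.expectation \<nu> max_value"
    using \<nu> \<open>splits p0 (map_pmf \<phi> \<mu>)\<close> by (auto simp: is_arg_max_linorder)
  finally show ?thesis .
qed

text \<open>A selection assigns one belief to each set, so different beliefs of the splitting need
  different sets; injectivity of the segments provides this.\<close>

lemma split_selection:
  assumes \<nu>: "splits p0 \<nu>"
  shows "\<exists>\<mu> \<phi>. verifiably_Bayes_plausible p0 \<mu> \<and> \<phi> \<in> verifying_selections p0 \<mu> \<and>
    selection_value A uS uR \<mu> \<phi> = measure_pmf.expectation \<nu> max_value"
proof -
  \<comment> \<open>Full segments rather than pairs of ends, because members of
    \<open>belief_sets\<close> are convex.\<close>
  define seg where "seg p = closed_segment p (partner p)" for p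
  define \<mu> where "\<mu> = map_pmf seg \<nu>"
  \<comment> \<open>Off the chosen segments any point of the set will do; it is needed since a
    selection must lie in every member of \<open>belief_sets\<close>.\<close>
  define \<phi> where "\<phi> P = (if P \<in> seg ` set_pmf \<nu> then inv_into (set_pmf \<nu>) seg P else SOME p. p \<in> P)" for P
  have fin: "finite (set_pmf \<nu>)" and bel: "\<And>p. p \<in> set_pmf \<nu> \<Longrightarrow> p \<in> beliefs"
    and exp: "measure_pmf.expectation \<nu> (\<lambda>p. p) = p0"
    using \<nu> by (auto simp: splits_def)
  have inj: "inj_on seg (set_pmf \<nu>)"
    using inj_on_partner_segment bel unfolding seg_def[abs_def] by (auto intro: inj_on_subset)
  have \<phi>_seg: "\<phi> (seg p) = p" if "p \<in> set_pmf \<nu>" for p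
    using that inj by (simp add: \<phi>_def)
  have pmf_seg: "pmf \<mu> (seg p) = pmf \<nu> p" if "p \<in> set_pmf \<nu>" for p
    unfolding \<mu>_def by (rule pmf_map_inj[OF inj that])
  have val: "sender_value (seg p) p = max_value p" for p
    by (simp add: seg_def sender_value_segment max_value_def)
  have supp: "set_pmf \<mu> = seg ` set_pmf \<nu>" by (simp add: \<mu>_def)
  have "seg p \<in> belief_sets" if "p \<in> set_pmf \<nu>" for p
    using bel[OF that] partner_in_beliefs[OF bel[OF that]] closed_segment_subset[OF _ _ convex_beliefs]
    by (simp add: belief_sets_def seg_def)
  then have supp_sub: "set_pmf \<mu> \<subseteq> belief_sets" by (auto simp: supp)
  have sum_supp: "(\<Sum>P\<in>set_pmf \<mu>. f P) = (\<Sum>p\<in>set_pmf \<nu>. f (seg p))" for f :: "_ \<Rightarrow> 'c::comm_monoid_add"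
    unfolding supp by (simp add: sum.reindex[OF inj])
  have "\<phi> P \<in> P" if P: "P \<in> belief_sets" for P
  proof (cases "P \<in> seg ` set_pmf \<nu>")
    case True
    then show ?thesis using \<phi>_seg by (auto simp: seg_def)
  next
    case False
    then show ?thesis using belief_setsD(1)[OF P] by (auto simp: \<phi>_def some_in_eq)
  qed
  moreover have "(\<Sum>P\<in>set_pmf \<mu>. pmf \<mu> P *\<^sub>R \<phi> P) = p0"
    unfolding exp[symmetric] sum_supp using fin
    by (subst integral_measure_pmf[of "set_pmf \<nu>"]) (auto simp: pmf_seg \<phi>_seg)
  ultimately have \<phi>: "\<phi> \<in> verifying_selections p0 \<mu>" by (simp add: verifying_selections_def)
  then have "verifiably_Bayes_plausible p0 \<mu>"
    using fin supp_sub by (auto simp: verifiably_Bayes_plausible_def supp)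
  moreover have "selection_value A uS uR \<mu> \<phi> = measure_pmf.expectation \<nu> max_value"
    unfolding selection_value_eq[OF supp_sub] sum_supp using fin
    by (subst integral_measure_pmf[of "set_pmf \<nu>"])
      (auto simp: pmf_seg \<phi>_seg val)
  ultimately show ?thesis using \<phi> by blast
qed

lemma utility_bound:
  obtains L where "0 \<le> L" "\<And>c p. c \<in> payoffs \<Longrightarrow> p \<in> beliefs \<Longrightarrow> \<bar>fst c \<bullet> p\<bar> \<le> L"
    "\<And>P p. P \<noteq> {} \<Longrightarrow> P \<subseteq> beliefs \<Longrightarrow> p \<in> beliefs \<Longrightarrow> - L \<le> sender_value P p"
proof -
  obtain L where L: "0 < L" "\<And>c. c \<in> payoffs \<Longrightarrow> norm c \<le> L"
    using compact_imp_bounded[OF compact_payoffs] bounded_pos by blast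
  have le: "\<bar>fst c \<bullet> p\<bar> \<le> L" if "c \<in> payoffs" "p \<in> beliefs" for c p
  proof -
    have "\<bar>fst c \<bullet> p\<bar> \<le> norm (fst c) * norm p" by (rule Cauchy_Schwarz_ineq2)
    also have "\<dots> \<le> norm (fst c) * 1"
      using norm_beliefs_le[OF that(2)] by (intro mult_left_mono) auto
    also have "\<dots> \<le> norm c" using norm_fst_le[of "fst c" "snd c"] by simp
    finally show ?thesis using L(2)[OF that(1)] by simp
  qed
  moreover have "- L \<le> sender_value P p" if P: "P \<noteq> {}" "P \<subseteq> beliefs" and p: "p \<in> beliefs" for P p
  proof -
    obtain c where "c \<in> best_payoffs P" "sender_value P p = fst c \<bullet> p"
      using sender_value_attained[OF P] .
    moreover have "\<bar>fst c \<bullet> p\<bar> \<le> L" if "c \<in> best_payoffs P" for c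
      using le best_payoffsD[OF that] p by blast
    ultimately show ?thesis by fastforce
  qed
  ultimately show thesis using L(1) by (intro that[of L]) auto
qed

subsection \<open>Ambiguous devices\<close>

definition device_payoff :: "real ^ 'w \<Rightarrow> nat set \<Rightarrow> ('w \<Rightarrow> nat \<Rightarrow> real) set \<Rightarrow> ('w \<Rightarrow> nat \<Rightarrow> real) \<Rightarrow> real" where
  "device_payoff p0 M D \<pi> = (\<Sum>m\<in>{m\<in>M. 0 < msg_prob p0 \<pi> m}.
     msg_prob p0 \<pi> m * sender_value (posterior_set p0 D m) (posterior p0 \<pi> m))"

lemma device_value_eq:
  assumes D: "ambiguous_device p0 M D" and p0: "p0 \<in> beliefs"
  shows "device_value A uS uR p0 M D = (INF \<pi>\<in>D. device_payoff p0 M D \<pi>)"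
  unfolding device_value_def device_payoff_def
proof (intro INF_cong refl sum.cong)
  fix \<pi> m assume "\<pi> \<in> D" "m \<in> {m\<in>M. 0 < msg_prob p0 \<pi> m}"
  then have "posterior_set p0 D m \<subseteq> beliefs" "posterior_set p0 D m \<noteq> {}"
    using posterior_set_beliefs[OF D p0] by blast+
  then show "msg_prob p0 \<pi> m * sender_util A uS uR (posterior_set p0 D m) (posterior p0 \<pi> m) =
      msg_prob p0 \<pi> m * sender_value (posterior_set p0 D m) (posterior p0 \<pi> m)"
    by (simp add: sender_util_eq)
qed

text \<open>The minimum over the device is at most the payoff of any single member, whose posteriors
  split the prior.\<close>

lemma device_value_le:
  assumes D: "ambiguous_device p0 M D" and p0: "p0 \<in> beliefs"
    and \<nu>: "is_arg_max (\<lambda>\<nu>. measure_pmf.expectation \<nu> max_value) (splits p0) \<nu>"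
  shows "device_value A uS uR p0 M D \<le> measure_pmf.expectation \<nu> max_value"
proof -
  let ?M = "\<lambda>\<pi>. {m\<in>M. 0 < msg_prob p0 \<pi> m}"
  have M: "finite M" and dev: "D \<subseteq> devices M" "D \<noteq> {}" using D by (auto simp: ambiguous_device_def)
  have sum1: "(\<Sum>m\<in>?M \<pi>. msg_prob p0 \<pi> m) = 1" if "\<pi> \<in> D" for \<pi>
  proof -
    have "\<pi> \<in> devices M" using that dev by blast
    then have "(\<Sum>m\<in>?M \<pi>. msg_prob p0 \<pi> m) = (\<Sum>m\<in>M. msg_prob p0 \<pi> m)"
      using M msg_prob_nonneg[OF _ p0] by (intro sum.mono_neutral_left) (auto simp: order.antisym not_less)
    then show ?thesis using sum_msg_prob[OF \<open>\<pi> \<in> devices M\<close> p0] by simp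
  qed
  obtain L where L: "\<And>P p. P \<noteq> {} \<Longrightarrow> P \<subseteq> beliefs \<Longrightarrow> p \<in> beliefs \<Longrightarrow> - L \<le> sender_value P p"
    using utility_bound by metis
  \<comment> \<open>A lower bound is required before the real infimum can be compared with a single
    payoff.\<close>
  have "- L \<le> device_payoff p0 M D \<pi>" if \<pi>: "\<pi> \<in> D" for \<pi>
  proof -
    have "- L = (\<Sum>m\<in>?M \<pi>. msg_prob p0 \<pi> m * - L)"
      unfolding sum_distrib_right[symmetric] sum1[OF \<pi>] by simp
    also have "\<dots> \<le> device_payoff p0 M D \<pi>"
      unfolding device_payoff_def
    proof (rule sum_mono)
      fix m assume m: "m \<in> ?M \<pi>"
      then have "posterior p0 \<pi> m \<in> posterior_set p0 D m" "posterior_set p0 D m \<subseteq> beliefs"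
        using posterior_set_beliefs[OF D p0 \<pi>] by auto
      then have "- L \<le> sender_value (posterior_set p0 D m) (posterior p0 \<pi> m)"
        by (intro L) auto
      then show "msg_prob p0 \<pi> m * - L \<le> msg_prob p0 \<pi> m * sender_value (posterior_set p0 D m) (posterior p0 \<pi> m)"
        using m by (intro mult_left_mono) auto
    qed
    finally show ?thesis .
  qed
  then have bdd: "bdd_below (device_payoff p0 M D ` D)" by (rule bdd_belowI2)
  obtain \<pi> where \<pi>: "\<pi> \<in> D" using dev by blast
  then have \<pi>_dev: "\<pi> \<in> devices M" using dev by blast
  obtain \<rho> where \<rho>: "\<And>m. pmf \<rho> m = (if m \<in> ?M \<pi> then msg_prob p0 \<pi> m else 0)" "set_pmf \<rho> \<subseteq> ?M \<pi>"
    using finite_weights_pmf[of "?M \<pi>" "msg_prob p0 \<pi>"] M sum1[OF \<pi>] by (auto simp: less_imp_le)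
  have exp: "measure_pmf.expectation \<rho> f = (\<Sum>m\<in>?M \<pi>. msg_prob p0 \<pi> m *\<^sub>R f m)"
    for f :: "nat \<Rightarrow> 'c::{banach, second_countable_topology}"
    using M \<rho> by (subst integral_measure_pmf[of "?M \<pi>"]) auto
  have split: "splits p0 (map_pmf (posterior p0 \<pi>) \<rho>)"
    unfolding splits_def integral_map_pmf exp sum_posterior[OF \<pi>_dev p0 M]
    using \<rho>(2) M posterior_beliefs[OF \<pi>_dev p0] by (auto intro: finite_subset)
  have "device_value A uS uR p0 M D \<le> device_payoff p0 M D \<pi>"
    unfolding device_value_eq[OF D p0] using bdd \<pi> by (rule cINF_lower)
  also have "\<dots> \<le> (\<Sum>m\<in>?M \<pi>. msg_prob p0 \<pi> m * max_value (posterior p0 \<pi> m))"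
    unfolding device_payoff_def using posterior_set_beliefs[OF D p0 \<pi>]
    by (intro sum_mono mult_left_mono sender_value_le_max_value) auto
  also have "\<dots> = measure_pmf.expectation (map_pmf (posterior p0 \<pi>) \<rho>) max_value"
    by (simp add: exp)
  also have "\<dots> \<le> measure_pmf.expectation \<nu> max_value"
    using \<nu> split by (auto simp: is_arg_max_linorder)
  finally show ?thesis .
qed

text \<open>The device mixes two devices. Each pair \<open>(pt i, partner (pt i))\<close> gets the messages \<open>2 * i\<close> and
  \<open>2 * i + 1\<close>. At either end of the mixture one of them induces \<open>pt i\<close> with almost the whole weight \<open>l i\<close>
  and the other induces the partner with weight \<open>\<eta> * c\<close>. As the value is homogeneous in the
  unnormalised posteriors, mixing costs nothing but the small weights. Message \<open>2 * n\<close> absorbs the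
  remaining mass, which does not depend on the mixture.\<close>

lemma almost_optimal_device:
  fixes p0 :: "real ^ 'w" and n :: nat
  assumes p0: "p0 \<in> beliefs" "\<And>\<omega>. 0 < p0 $ \<omega>"
    and pt: "\<And>i. i < n \<Longrightarrow> pt i \<in> beliefs" and l: "\<And>i. i < n \<Longrightarrow> 0 < l i"
    and split: "(\<Sum>i<n. l i *\<^sub>R pt i) = p0"
    and \<eta>: "0 < \<eta>" "\<eta> < 1"
    and L: "0 \<le> L" "\<And>c p. c \<in> payoffs \<Longrightarrow> p \<in> beliefs \<Longrightarrow> \<bar>fst c \<bullet> p\<bar> \<le> L"
      "\<And>P p. P \<noteq> {} \<Longrightarrow> P \<subseteq> beliefs \<Longrightarrow> p \<in> beliefs \<Longrightarrow> - L \<le> sender_value P p"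
  shows "\<exists>M D. ambiguous_device p0 M D \<and>
    (1 - \<eta>) * (\<Sum>i<n. l i * max_value (pt i)) - 2 * \<eta> * L \<le> device_value A uS uR p0 M D"
proof -
  define q where "q i = partner (pt i)" for i
  have q: "q i \<in> beliefs" if "i < n" for i
    using partner_in_beliefs[OF pt[OF that]] by (simp add: q_def)
  define \<delta> where "\<delta> = Min (range (($) p0))"
  \<comment> \<open>Coordinates of beliefs are at most 1, so \<open>c * n < \<delta>\<close> leaves
    \<open>R\<close> positive everywhere. The added 1 makes this strict and covers
    \<open>n = 0\<close>.\<close>
  define c where "c = \<delta> / (n + 1)"
  have \<delta>: "0 < \<delta>" "\<And>\<omega>. \<delta> \<le> p0 $ \<omega>"
    using p0(2) by (auto simp: \<delta>_def)
  have c: "0 < c" "c * n < \<delta>"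
    using \<delta>(1) by (auto simp: c_def field_simps)
  have le1: "p $ \<omega> \<le> 1" if "p \<in> beliefs" for p :: "real ^ 'w" and \<omega>
    using that member_le_sum[of \<omega> UNIV "\<lambda>\<omega>. p $ \<omega>"] by (auto simp: beliefs_def)
  have ge0: "0 \<le> p $ \<omega>" if "p \<in> beliefs" for p :: "real ^ 'w" and \<omega>
    using that by (simp add: beliefs_def)
  have cn: "c * n < 1"
    using c(2) \<delta>(2)[of undefined] le1[OF p0(1), of undefined] by linarith
  \<comment> \<open>Scaled by \<open>\<eta>\<close>, this is exactly what is missing from the prior
    after the pairs have used \<open>(1 - \<eta>)\<close> of the splitting and
    \<open>\<eta> * c\<close> of each partner.\<close>
  define R where "R = p0 - c *\<^sub>R (\<Sum>i<n. q i)"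
  have R_pos: "0 < R $ \<omega>" for \<omega>
  proof -
    have "(\<Sum>i<n. q i $ \<omega>) \<le> (\<Sum>i<n. 1)" by (intro sum_mono le1 q) auto
    then have "c * (\<Sum>i<n. q i $ \<omega>) \<le> c * n" using c(1) by (intro mult_left_mono) auto
    then show ?thesis using c(2) \<delta>(2)[of \<omega>] by (simp add: R_def)
  qed
  have one_R: "1 \<bullet> R = 1 - c * n"
    using one_inner_beliefs[OF q] one_inner_beliefs[OF p0(1)] by (simp add: R_def inner_diff_right inner_sum_right)
  \<comment> \<open>The share of \<open>pt\<close> carried by \<open>m\<close>: everything on even
    messages at \<open>t = 0\<close>, everything on odd ones at \<open>t = 1\<close>. The shares in
    a pair add up to 1.\<close>
  define w where "w t m = (if even m then 1 - t else t)" for t :: real and m :: nat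
  have w: "0 \<le> w t m" "w t m \<le> 1" if "t \<in> {0..1}" for t m using that by (auto simp: w_def)
  define u where "u t m = w t m * (1 - \<eta>) * l (m div 2)" for t m
  define v where "v t m = (1 - w t m) * \<eta> * c" for t m
  \<comment> \<open>\<open>x t m\<close> is the unnormalised posterior of \<open>m\<close>. Dividing
    it by the prior, as \<open>dev\<close> does, gives conditional message probabilities; full
    support permits this.\<close>
  define x where "x t m = (if m < 2 * n then u t m *\<^sub>R pt (m div 2) + v t m *\<^sub>R q (m div 2)
     else if m = 2 * n then \<eta> *\<^sub>R R else 0)" for t m
  define M where "M = {..<Suc (2 * n)}"
  define dev where "dev t \<omega> m = x t m $ \<omega> / p0 $ \<omega>" for t \<omega> m
  define D where "D = dev ` {0..1}"
  have idx: "m div 2 < n" if "m < 2 * n" for m using that by auto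
  have uv: "0 \<le> u t m" "0 \<le> v t m" "0 < u t m + v t m" if "t \<in> {0..1}" "m < 2 * n" for t m
  proof -
    have pos: "0 < (1 - \<eta>) * l (m div 2)" "0 < \<eta> * c" using \<eta> l[OF idx[OF that(2)]] c(1) by auto
    have eqs: "u t m = w t m * ((1 - \<eta>) * l (m div 2))" "v t m = (1 - w t m) * (\<eta> * c)"
      by (simp_all add: u_def v_def)
    show nn: "0 \<le> u t m" "0 \<le> v t m"
      using pos w[OF that(1), of m] by (auto simp: eqs)
    show "0 < u t m + v t m"
    proof (cases "w t m = 0")
      case True then show ?thesis using pos by (simp add: eqs)
    next
      case False
      then have "0 < u t m" using w[OF that(1), of m] pos by (simp add: eqs)
      then show ?thesis using nn by simp
    qed
  qed
  have x_nonneg: "0 \<le> x t m $ \<omega>" if "t \<in> {0..1}" for t m \<omega>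
    using uv[OF that] R_pos[of \<omega>] \<eta> ge0[OF pt] ge0[OF q] idx[of m]
    by (auto simp: x_def intro!: add_nonneg_nonneg mult_nonneg_nonneg)
  have x_pair: "x t (2 * i) + x t (2 * i + 1) = ((1 - \<eta>) * l i) *\<^sub>R pt i + (\<eta> * c) *\<^sub>R q i" if "i < n" for t i
  proof -
    have "u t (2 * i) + u t (2 * i + 1) = (1 - \<eta>) * l i" "v t (2 * i) + v t (2 * i + 1) = \<eta> * c"
      by (simp_all add: u_def v_def w_def algebra_simps)
    then have "(u t (2 * i) + u t (2 * i + 1)) *\<^sub>R pt i + (v t (2 * i) + v t (2 * i + 1)) *\<^sub>R q i =
        ((1 - \<eta>) * l i) *\<^sub>R pt i + (\<eta> * c) *\<^sub>R q i" by simp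
    then show ?thesis using that by (simp add: x_def scaleR_add_left add_ac)
  qed
  have x_sum: "(\<Sum>m\<in>M. x t m) = p0" for t
  proof -
    have "(\<Sum>m\<in>M. x t m) = (\<Sum>i<n. ((1 - \<eta>) * l i) *\<^sub>R pt i + (\<eta> * c) *\<^sub>R q i) + \<eta> *\<^sub>R R"
      unfolding M_def sum.lessThan_Suc sum_lessThan_double
      using x_pair by (simp add: x_def[of _ "2 * n"])
    also have "(\<Sum>i<n. ((1 - \<eta>) * l i) *\<^sub>R pt i + (\<eta> * c) *\<^sub>R q i) =
        (1 - \<eta>) *\<^sub>R (\<Sum>i<n. l i *\<^sub>R pt i) + (\<eta> * c) *\<^sub>R (\<Sum>i<n. q i)"
      by (simp add: sum.distrib scaleR_sum_right)
    finally show ?thesis unfolding split by (simp add: R_def algebra_simps)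
  qed
  have msg: "msg_prob p0 (dev t) m = 1 \<bullet> x t m" for t m
    using p0(2) by (simp add: msg_prob_def dev_def inner_vec_def less_imp_neq[symmetric])
  have msg_low: "msg_prob p0 (dev t) m = u t m + v t m" if "m < 2 * n" for t m
    using that one_inner_beliefs[OF pt[OF idx]] one_inner_beliefs[OF q[OF idx]]
    by (simp add: msg x_def inner_add_right)
  have msg_top: "msg_prob p0 (dev t) (2 * n) = \<eta> * (1 - c * n)" for t
    by (simp add: msg x_def one_R)
  have msg_pos: "0 < msg_prob p0 (dev t) m" if "t \<in> {0..1}" "m \<in> M" for t m
    using that uv(3)[OF that(1)] msg_low msg_top[of t] \<eta> cn
    by (cases "m < 2 * n") (auto simp: M_def less_Suc_eq)
  have post: "posterior p0 (dev t) m = (1 / msg_prob p0 (dev t) m) *\<^sub>R x t m" for t m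
    using p0(2) by (simp add: posterior_def dev_def vec_eq_iff less_imp_neq[symmetric])
  have devices: "dev t \<in> devices M" if "t \<in> {0..1}" for t
    unfolding devices_def
  proof safe
    fix \<omega> m
    show "0 \<le> dev t \<omega> m" using x_nonneg[OF that] p0(2) by (simp add: dev_def less_imp_le)
    show "dev t \<omega> m = 0" if "m \<notin> M" using that by (auto simp: dev_def x_def M_def)
    have "(\<Sum>m\<in>M. x t m $ \<omega>) = p0 $ \<omega>"
      using x_sum[of t] by (metis sum_component)
    then show "(\<Sum>m\<in>M. dev t \<omega> m) = 1"
      using p0(2)[of \<omega>] by (simp add: dev_def sum_divide_distrib[symmetric])
  qed
  \<comment> \<open>Affinity in \<open>t\<close> makes the image of the unit interval
    convex.\<close>
  have x_affine: "x ((1 - s) * t + s * t') m = (1 - s) *\<^sub>R x t m + s *\<^sub>R x t' m" for s t t' m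
  proof -
    have "u ((1 - s) * t + s * t') m = (1 - s) * u t m + s * u t' m"
      "v ((1 - s) * t + s * t') m = (1 - s) * v t m + s * v t' m"
      by (simp_all add: u_def v_def w_def algebra_simps)
    moreover have "(s * \<eta>) *\<^sub>R R + ((1 - s) * \<eta>) *\<^sub>R R = \<eta> *\<^sub>R R"
      by (simp add: algebra_simps)
    ultimately show ?thesis
      by (simp add: x_def scaleR_add_left scaleR_add_right add_ac)
  qed
  have "closed D"
  proof -
    have "continuous_on {0..1} (\<lambda>t. dev t \<omega> m)" for \<omega> m
      unfolding dev_def x_def u_def v_def w_def using p0(2)
      by (cases "even m"; cases "m < 2 * n"; cases "m = 2 * n")
        (auto intro!: continuous_intros simp: less_imp_neq[symmetric])
    then have "continuous_on {0..1} dev"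
      by (intro continuous_on_coordinatewise_then_product)
    then show ?thesis
      unfolding D_def by (intro compact_imp_closed compact_continuous_image) auto
  qed
  moreover have "(\<lambda>\<omega> m. (1 - s) * \<pi> \<omega> m + s * \<pi>' \<omega> m) \<in> D"
    if \<pi>: "\<pi> \<in> D" "\<pi>' \<in> D" and s: "s \<in> {0..1}" for \<pi> \<pi>' s
  proof -
    obtain t t' where t: "\<pi> = dev t" "t \<in> {0..1}" "\<pi>' = dev t'" "t' \<in> {0..1}"
      using \<pi> by (auto simp: D_def)
    have "(\<lambda>\<omega> m. (1 - s) * \<pi> \<omega> m + s * \<pi>' \<omega> m) = dev ((1 - s) * t + s * t')"
      by (intro ext) (simp add: t dev_def x_affine add_divide_distrib)
    moreover have "(1 - s) * t + s * t' \<in> {0..1}"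
      using convexD_alt[OF convex_real_interval(5)[of 0 1] t(2,4), of s] s by simp
    ultimately show ?thesis by (simp add: D_def)
  qed
  ultimately have D: "ambiguous_device p0 M D"
    unfolding ambiguous_device_def using devices msg_pos by (auto simp: D_def M_def)
  have best: "best_payoffs (posterior_set p0 D m) = best_payoffs {pt (m div 2), q (m div 2)}"
    if m: "m < 2 * n" for m
  proof (rule best_payoffs_pair)
    \<comment> \<open>The end of the mixture at which \<open>m\<close> induces \<open>pt\<close>
      exactly; at the other end it induces the partner.\<close>
    let ?t = "if even m then 0 else 1 :: real"
    have post': "posterior p0 (dev t) m = (1 / (u t m + v t m)) *\<^sub>R (u t m *\<^sub>R pt (m div 2) + v t m *\<^sub>R q (m div 2))" for t
      unfolding post msg_low[OF m] using m by (simp add: x_def)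
    have "w ?t m = 1" "w (1 - ?t) m = 0" by (auto simp: w_def)
    then have "v ?t m = 0" "u (1 - ?t) m = 0" by (simp_all add: u_def v_def)
    then have "posterior p0 (dev ?t) m = pt (m div 2)" "posterior p0 (dev (1 - ?t)) m = q (m div 2)"
      unfolding post' using uv(3)[of ?t m] uv(3)[of "1 - ?t" m] m by auto
    moreover have "dev ?t \<in> D" "dev (1 - ?t) \<in> D" by (auto simp: D_def)
    ultimately show "{pt (m div 2), q (m div 2)} \<subseteq> posterior_set p0 D m"
      unfolding posterior_set_def by (metis empty_subsetI image_eqI insert_subset)
    show "posterior_set p0 D m \<subseteq> closed_segment (pt (m div 2)) (q (m div 2))"
    proof
      fix p assume "p \<in> posterior_set p0 D m"
      then obtain t where t: "t \<in> {0..1}" "p = posterior p0 (dev t) m" by (auto simp: posterior_set_def D_def)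
      let ?s = "v t m / (u t m + v t m)"
      have "1 - ?s = u t m / (u t m + v t m)" using uv(3)[OF t(1) m] by (simp add: field_simps)
      then have "p = (1 - ?s) *\<^sub>R pt (m div 2) + ?s *\<^sub>R q (m div 2)"
        by (simp add: t(2) post' scaleR_add_right)
      moreover have "0 \<le> ?s" "?s \<le> 1" using uv[OF t(1) m] by auto
      ultimately show "p \<in> closed_segment (pt (m div 2)) (q (m div 2))"
        unfolding in_segment by blast
    qed
  qed
  have payoff_ge: "(1 - \<eta>) * (\<Sum>i<n. l i * max_value (pt i)) - 2 * \<eta> * L \<le> device_payoff p0 M D \<pi>"
    if \<pi>: "\<pi> \<in> D" for \<pi>
  proof -
    obtain t where t: "t \<in> {0..1}" "\<pi> = dev t" using \<pi> by (auto simp: D_def)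
    let ?g = "\<lambda>m. msg_prob p0 (dev t) m * sender_value (posterior_set p0 D m) (posterior p0 (dev t) m)"
    \<comment> \<open>One response \<open>a\<close>, optimal for the sender at \<open>pt\<close>,
      remains a best response after \<open>m\<close> whatever \<open>t\<close> is. Its payoff times
      the message probability is linear in \<open>x t m\<close>, so only the partner's weight costs
      anything.\<close>
    have low: "u t m * max_value (pt (m div 2)) - v t m * L \<le> ?g m" if m: "m < 2 * n" for m
    proof -
      let ?i = "m div 2"
      obtain a where a: "a \<in> best_payoffs {pt ?i, q ?i}" "max_value (pt ?i) = fst a \<bullet> pt ?i"
        using sender_value_attained[of "{pt ?i, q ?i}" "pt ?i"] pt[OF idx[OF m]] q[OF idx[OF m]]
        by (auto simp: max_value_def q_def)
      have "- L \<le> fst a \<bullet> q ?i" using L(2)[OF best_payoffsD[OF a(1)] q[OF idx[OF m]]] by simp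
      then have "v t m * - L \<le> v t m * (fst a \<bullet> q ?i)"
        using uv(2)[OF t(1) m] by (rule mult_left_mono)
      then have "u t m * max_value (pt ?i) - v t m * L \<le> fst a \<bullet> x t m"
        using m by (simp add: x_def inner_add_right a(2))
      also have "\<dots> = msg_prob p0 (dev t) m * (fst a \<bullet> posterior p0 (dev t) m)"
        using msg_pos[OF t(1), of m] m by (simp add: post M_def)
      also have "\<dots> \<le> ?g m"
        using msg_pos[OF t(1), of m] m a(1) best[OF m] by (intro mult_left_mono sender_value_ge) (auto simp: M_def)
      finally show ?thesis .
    qed
    have "2 * n \<in> M" by (simp add: M_def)
    then have top: "- (\<eta> * L) \<le> ?g (2 * n)"
    proof -
      have "- L \<le> sender_value (posterior_set p0 D (2 * n)) (posterior p0 (dev t) (2 * n))"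
        using posterior_set_beliefs[OF D p0(1) \<pi>[unfolded t(2)] \<open>2 * n \<in> M\<close> msg_pos[OF t(1) \<open>2 * n \<in> M\<close>]]
        by (intro L(3)) auto
      then have "msg_prob p0 (dev t) (2 * n) * - L \<le> ?g (2 * n)"
        using msg_pos[OF t(1) \<open>2 * n \<in> M\<close>] by (intro mult_left_mono) auto
      moreover have "msg_prob p0 (dev t) (2 * n) * L \<le> \<eta> * L"
        unfolding msg_top using L(1) \<eta> c(1) by (intro mult_right_mono) (auto simp: mult_le_cancel_left1)
      ultimately show ?thesis by simp
    qed
    \<comment> \<open>Summing over a pair cancels \<open>t\<close>, so the bound is the same for
      every member of \<open>D\<close>.\<close>
    have pair: "(1 - \<eta>) * (l i * max_value (pt i)) - \<eta> * c * L \<le> ?g (2 * i) + ?g (2 * i + 1)" if "i < n" for i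
    proof -
      have "u t (2 * i) + u t (2 * i + 1) = (1 - \<eta>) * l i" "v t (2 * i) + v t (2 * i + 1) = \<eta> * c"
        by (simp_all add: u_def v_def w_def algebra_simps)
      then have "(1 - \<eta>) * (l i * max_value (pt i)) - \<eta> * c * L =
          (u t (2 * i) + u t (2 * i + 1)) * max_value (pt i) - (v t (2 * i) + v t (2 * i + 1)) * L"
        by simp
      also have "\<dots> = (u t (2 * i) * max_value (pt i) - v t (2 * i) * L) +
          (u t (2 * i + 1) * max_value (pt i) - v t (2 * i + 1) * L)"
        by (simp add: algebra_simps)
      also have "\<dots> \<le> ?g (2 * i) + ?g (2 * i + 1)"
        using low[of "2 * i"] low[of "2 * i + 1"] that by (intro add_mono) auto
      finally show ?thesis .
    qed
    have "(1 - \<eta>) * (\<Sum>i<n. l i * max_value (pt i)) - \<eta> * L * (c * n) =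
        (\<Sum>i<n. (1 - \<eta>) * (l i * max_value (pt i)) - \<eta> * c * L)"
      by (simp add: sum_subtractf sum_distrib_left)
    also have "\<dots> \<le> (\<Sum>i<n. ?g (2 * i) + ?g (2 * i + 1))"
      by (intro sum_mono pair) auto
    finally have "(1 - \<eta>) * (\<Sum>i<n. l i * max_value (pt i)) - \<eta> * L * (c * n) - \<eta> * L \<le> (\<Sum>m\<in>M. ?g m)"
      unfolding M_def sum.lessThan_Suc sum_lessThan_double using top by linarith
    \<comment> \<open>The partners and the residual message each lose at most
      \<open>\<eta> * L\<close>.\<close>
    moreover have "\<eta> * L * (c * n) \<le> \<eta> * L * 1"
      using cn \<eta>(1) L(1) by (intro mult_left_mono) auto
    moreover have "{m \<in> M. 0 < msg_prob p0 \<pi> m} = M" using msg_pos[OF t(1)] by (auto simp: t(2))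
    ultimately show ?thesis unfolding device_payoff_def t(2) by simp
  qed
  have "D \<noteq> {}" by (simp add: D_def)
  then have "(1 - \<eta>) * (\<Sum>i<n. l i * max_value (pt i)) - 2 * \<eta> * L \<le> device_value A uS uR p0 M D"
    unfolding device_value_eq[OF D p0(1)] using payoff_ge by (rule cINF_greatest)
  with D show ?thesis by blast
qed

text \<open>Letting \<open>\<eta>\<close> tend to 0 in the approximating devices closes the gap to
  the upper bound, which is why a supremum over devices suffices.\<close>

lemma optimal_value_eq:
  assumes p0: "p0 \<in> beliefs" "\<And>\<omega>. 0 < p0 $ \<omega>"
    and \<nu>: "is_arg_max (\<lambda>\<nu>. measure_pmf.expectation \<nu> max_value) (splits p0) \<nu>"
  shows "optimal_value A uS uR p0 = ereal (measure_pmf.expectation \<nu> max_value)"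
proof (rule antisym)
  let ?V = "measure_pmf.expectation \<nu> max_value"
  show "optimal_value A uS uR p0 \<le> ereal ?V"
    unfolding optimal_value_def using device_value_le[OF _ p0(1) \<nu>] by (auto intro!: Sup_least)
  have fin: "finite (set_pmf \<nu>)" and bel: "set_pmf \<nu> \<subseteq> beliefs"
    and mean: "measure_pmf.expectation \<nu> (\<lambda>p. p) = p0"
    using \<nu> by (auto simp: is_arg_max_def splits_def)
  \<comment> \<open>Enumerating the support gives the indexed points with positive weights that the
    device construction expects.\<close>
  obtain pt where pt: "bij_betw pt {..<card (set_pmf \<nu>)} (set_pmf \<nu>)"
    using ex_bij_betw_nat_finite[OF fin] by (auto simp: atLeast0LessThan)
  let ?n = "card (set_pmf \<nu>)"
  have exp: "measure_pmf.expectation \<nu> f = (\<Sum>i<?n. pmf \<nu> (pt i) *\<^sub>R f (pt i))"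
    for f :: "_ \<Rightarrow> 'c::{banach, second_countable_topology}"
    using sum.reindex_bij_betw[OF pt, of "\<lambda>p. pmf \<nu> p *\<^sub>R f p"] fin
    by (subst integral_measure_pmf[of "set_pmf \<nu>"]) auto
  have mem: "pt i \<in> set_pmf \<nu>" if "i < ?n" for i
    using bij_betw_apply[OF pt] that by simp
  obtain L where L: "0 \<le> L" "\<And>c p. c \<in> payoffs \<Longrightarrow> p \<in> beliefs \<Longrightarrow> \<bar>fst c \<bullet> p\<bar> \<le> L"
    "\<And>P p. P \<noteq> {} \<Longrightarrow> P \<subseteq> beliefs \<Longrightarrow> p \<in> beliefs \<Longrightarrow> - L \<le> sender_value P p"
    using utility_bound by metis
  have le: "ereal ((1 - \<eta>) * ?V - 2 * \<eta> * L) \<le> optimal_value A uS uR p0" if \<eta>: "0 < \<eta>" "\<eta> < 1" for \<eta>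
  proof -
    have "\<exists>M D. ambiguous_device p0 M D \<and>
        (1 - \<eta>) * (\<Sum>i<?n. pmf \<nu> (pt i) * max_value (pt i)) - 2 * \<eta> * L \<le> device_value A uS uR p0 M D"
      using mem bel mean unfolding exp
      by (intro almost_optimal_device p0 \<eta> L) (auto simp: pmf_positive)
    then obtain M D where "ambiguous_device p0 M D"
      "(1 - \<eta>) * ?V - 2 * \<eta> * L \<le> device_value A uS uR p0 M D"
      unfolding exp by auto
    then show ?thesis
      unfolding optimal_value_def by (intro Sup_upper2[of "ereal (device_value A uS uR p0 M D)"]) auto
  qed
  have "((\<lambda>\<eta>. ereal ((1 - \<eta>) * ?V - 2 * \<eta> * L)) \<longlongrightarrow> ereal ((1 - 0) * ?V - 2 * 0 * L)) (at_right 0)"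
    by (intro tendsto_intros)
  moreover have "\<forall>\<^sub>F \<eta> in at_right 0. ereal ((1 - \<eta>) * ?V - 2 * \<eta> * L) \<le> optimal_value A uS uR p0"
    using le by (auto simp: eventually_at_right_field intro!: exI[of _ 1])
  ultimately have "ereal ((1 - 0) * ?V - 2 * 0 * L) \<le> optimal_value A uS uR p0"
    by (rule tendsto_upperbound) simp
  then show "ereal ?V \<le> optimal_value A uS uR p0" by simp
qed

end

text \<open>The first conjunct shows that the supremum defining \<open>max_selection_value\<close>
  is attained, so that it is a genuine maximum.\<close>

theorem corollary3p7:
  fixes p0 :: "real ^ 'w::finite"
    and A :: "'a::topological_space set"
    and uS uR :: "'a \<Rightarrow> 'w \<Rightarrow> real"
  assumes "p0 \<in> beliefs" and "\<And>\<omega>. 0 < p0 $ \<omega>"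
    and "compact A" and "A \<noteq> {}"
    and "\<And>\<omega>. continuous_on A (\<lambda>a. uS a \<omega>)"
    and "\<And>\<omega>. continuous_on A (\<lambda>a. uR a \<omega>)"
  shows "(\<forall>\<mu>. verifiably_Bayes_plausible p0 \<mu> \<longrightarrow>
            (\<exists>\<phi>. is_arg_max (selection_value A uS uR \<mu>) (\<lambda>\<phi>. \<phi> \<in> verifying_selections p0 \<mu>) \<phi>)) \<and>
         (\<exists>\<mu>. is_arg_max (max_selection_value A uS uR p0) (verifiably_Bayes_plausible p0) \<mu> \<and>
            optimal_value A uS uR p0 = ereal (max_selection_value A uS uR p0 \<mu>))"
proof -
  interpret persuasion A uS uR
    using assms(3-6) by unfold_locales
  obtain \<nu> where \<nu>: "is_arg_max (\<lambda>\<nu>. measure_pmf.expectation \<nu> max_value) (splits p0) \<nu>"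
    using optimal_split[OF assms(1)] by blast
  let ?V = "measure_pmf.expectation \<nu> max_value"
  have max_le: "max_selection_value A uS uR p0 \<mu> \<le> ?V" if "verifiably_Bayes_plausible p0 \<mu>" for \<mu>
    unfolding max_selection_value_def using that selection_value_le[OF that _ \<nu>]
    by (intro cSUP_least) (auto simp: verifiably_Bayes_plausible_def)
  obtain \<mu> \<phi> where \<mu>: "verifiably_Bayes_plausible p0 \<mu>" "\<phi> \<in> verifying_selections p0 \<mu>"
    "selection_value A uS uR \<mu> \<phi> = ?V"
    using split_selection[of p0 \<nu>] \<nu> by (auto simp: is_arg_max_def)
  \<comment> \<open>Without an upper bound the real supremum need not dominate the value of the
    constructed selection.\<close>
  have "bdd_above (selection_value A uS uR \<mu> ` verifying_selections p0 \<mu>)"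
    using selection_value_le[OF \<mu>(1) _ \<nu>] by (rule bdd_aboveI2)
  then have "?V \<le> max_selection_value A uS uR p0 \<mu>"
    unfolding max_selection_value_def \<mu>(3)[symmetric] using \<mu>(2) by (intro cSUP_upper)
  then have "max_selection_value A uS uR p0 \<mu> = ?V"
    using max_le[OF \<mu>(1)] by simp
  then show ?thesis
    using optimal_selection max_le \<mu>(1) optimal_value_eq[OF assms(1,2) \<nu>]
    by (auto simp: is_arg_max_linorder intro!: exI[of _ \<mu>])
qed

end
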